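(* Let $d\ge1$ and let $\{\nu_\varepsilon\}_{\varepsilon>0}$ be a family of positive Borel measures on $\mathbb{R}^d$ with $\int_{\mathbb{R}^d}(1\wedge|x|)\,\nu_\varepsilon(\mathrm{d}x)<\infty$ and $\nu_\varepsilon(\{0\})=0$. For each $\varepsilon>0$ let $R_\varepsilon\in[1,\infty]$, let $C_\varepsilon=\int_{\mathbb{R}^d}(R_\varepsilon\wedge|x|)\,\nu_\varepsilon(\mathrm{d}x)$ with $0<C_\varepsilon<\infty$, and let $$\lambda_\varepsilon(\mathrm{d}x)=C_\varepsilon^{-1}(R_\varepsilon\wedge|x|)\,\nu_\varepsilon(\mathrm{d}x).$$ Let $\mu_\varepsilon$ be the probability measure on $\mathbb{S}^{d-1}$ given by $\mu_\varepsilon(E)=\lambda_\varepsilon((0,\infty)E)$ for Borel $E\subset\mathbb{S}^{d-1}$. Suppose that $\lim_{\varepsilon\downarrow0}\lambda_\varepsilon(B_R^c)=0$ for every $R>0$. Then there exist a sequence $\varepsilon_j$ converging to zero and a probability measure $\mu$ on $\mathbb{S}^{d-1}$ which is the weak limit of $\{\mu_{\varepsilon_j}\}$, such that for every $f\in\mathrm{BV}(\mathbb{R}^d)$ $$\lim_{j\to\infty}C_{\varepsilon_j}^{-1}\mathcal{F}_{\nu_{\varepsilon_j}}(f)=\frac12\int_{\mathbb{S}^{d-1}}\int_{\mathbb{R}^d}|Df\cdot\theta|\,\mu(\mathrm{d}\theta).$$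
   Context: $a\wedge b=\min(a,b)$ (with $\infty\wedge a=a$). $B_R$ is the closed Euclidean ball of radius $R$ centred at $0$. For $E\subset\mathbb{S}^{d-1}$, $(0,\infty)E=\{re: r>0,\ e\in E\}$. For a positive Borel measure $\nu$ on $\mathbb{R}^d$, $\mathcal{F}_\nu(u)=\frac12\int_{\mathbb{R}^d}\int_{\mathbb{R}^d}|u(x+y)-u(y)|\,\nu(\mathrm{d}x)\,\mathrm{d}y$. $\mathrm{BV}(\mathbb{R}^d)$ is the space of $u\in L^1(\mathbb{R}^d)$ whose distributional gradient $Du$ is an $\mathbb{R}^d$-valued Radon measure of finite total variation. For $\theta\in\mathbb{S}^{d-1}$, $|Df\cdot\theta|$ is the total variation measure of the scalar signed measure $Df\cdot\theta$, and $\int_{\mathbb{R}^d}|Df\cdot\theta|=|Df\cdot\theta|(\mathbb{R}^d)$. *)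

theory Defs
  imports "HOL-Probability.Probability"
begin

text \<open>Euclidean space is an arbitrary type of class \<open>euclidean_space\<close>, so its dimension is an
  arbitrary \<open>d \<ge> 1\<close>. Quantities that are integrals of nonnegative functions live in \<open>ennreal\<close>.\<close>

subsection \<open>Vector-valued measures and total variation\<close>

definition vector_measure :: "('a::topological_space set \<Rightarrow> 'b::real_normed_vector) \<Rightarrow> bool" where
  "vector_measure m \<longleftrightarrow> m {} = 0 \<and>
     (\<forall>A :: nat \<Rightarrow> 'a set. range A \<subseteq> sets borel \<longrightarrow> disjoint_family A \<longrightarrow>
        (\<lambda>n. m (A n)) sums m (\<Union>n. A n))"

definition variation :: "('a::topological_space set \<Rightarrow> 'b::real_normed_vector) \<Rightarrow> 'a set \<Rightarrow> ennreal" where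
  "variation m E =
     (SUP A \<in> {A :: nat \<Rightarrow> 'a set. range A \<subseteq> sets borel \<and> disjoint_family A \<and> (\<Union>n. A n) = E}.
        \<Sum>n. ennreal (norm (m (A n))))"

text \<open>The Jordan parts \<open>(\<bar>s\<bar> + s) / 2\<close> and \<open>(\<bar>s\<bar> - s) / 2\<close> of a signed measure \<open>s\<close> of finite
  total variation.\<close>

definition jordan_pos :: "('a::topological_space set \<Rightarrow> real) \<Rightarrow> 'a measure" where
  "jordan_pos s =
     measure_of UNIV (sets borel) (\<lambda>A. ennreal ((enn2real (variation s A) + s A) / 2))"

definition jordan_neg :: "('a::topological_space set \<Rightarrow> real) \<Rightarrow> 'a measure" where
  "jordan_neg s =
     measure_of UNIV (sets borel) (\<lambda>A. ennreal ((enn2real (variation s A) - s A) / 2))"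

definition signed_integral :: "('a::topological_space set \<Rightarrow> real) \<Rightarrow> ('a \<Rightarrow> real) \<Rightarrow> real" where
  "signed_integral s \<phi> = (\<integral>x. \<phi> x \<partial>jordan_pos s) - (\<integral>x. \<phi> x \<partial>jordan_neg s)"

subsection \<open>Distributional gradients and functions of bounded variation\<close>

definition partial_deriv :: "'a::euclidean_space \<Rightarrow> ('a \<Rightarrow> real) \<Rightarrow> 'a \<Rightarrow> real" where
  "partial_deriv b \<phi> = (\<lambda>x. frechet_derivative \<phi> (at x) b)"

primrec times_differentiable :: "nat \<Rightarrow> ('a::euclidean_space \<Rightarrow> real) \<Rightarrow> bool" where
  "times_differentiable 0 \<phi> \<longleftrightarrow> continuous_on UNIV \<phi>"
| "times_differentiable (Suc k) \<phi> \<longleftrightarrow>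
     (\<forall>x. \<phi> differentiable (at x)) \<and> (\<forall>b\<in>Basis. times_differentiable k (partial_deriv b \<phi>))"

definition test_function :: "('a::euclidean_space \<Rightarrow> real) \<Rightarrow> bool" where
  "test_function \<phi> \<longleftrightarrow> (\<forall>k. times_differentiable k \<phi>) \<and> compact (closure {x. \<phi> x \<noteq> 0})"

text \<open>The \<open>\<real>\<^sup>d\<close>-valued finite Radon measure \<open>D\<close> represents the distributional gradient of \<open>u\<close>.
  Such a \<open>D\<close> is determined by \<open>u\<close> on the Borel sets; its values on other sets are irrelevant.\<close>

definition gradient_measure :: "('a::euclidean_space \<Rightarrow> real) \<Rightarrow> ('a set \<Rightarrow> 'a) \<Rightarrow> bool" where
  "gradient_measure u D \<longleftrightarrow> vector_measure D \<and> variation D UNIV < \<infinity> \<and>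
     (\<forall>b\<in>Basis. \<forall>\<phi>. test_function \<phi> \<longrightarrow>
        (\<integral>x. u x * partial_deriv b \<phi> x \<partial>lborel) = - signed_integral (\<lambda>A. D A \<bullet> b) \<phi>)"

definition BV :: "('a::euclidean_space \<Rightarrow> real) set" where
  "BV = {u. integrable lborel u \<and> (\<exists>D. gradient_measure u D)}"

subsection \<open>The nonlocal functional and the rescaled measures\<close>

definition nonlocal_energy :: "'a::euclidean_space measure \<Rightarrow> ('a \<Rightarrow> real) \<Rightarrow> ennreal" where
  "nonlocal_energy \<nu> u =
     1 / 2 * (\<integral>\<^sup>+ y. (\<integral>\<^sup>+ x. ennreal \<bar>u (x + y) - u y\<bar> \<partial>\<nu>) \<partial>lborel)"

definition truncated_moment :: "ennreal \<Rightarrow> 'a::euclidean_space measure \<Rightarrow> ennreal" where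
  "truncated_moment R \<nu> = (\<integral>\<^sup>+ x. min R (ennreal (norm x)) \<partial>\<nu>)"

definition rescaled_measure :: "ennreal \<Rightarrow> 'a::euclidean_space measure \<Rightarrow> 'a measure" where
  "rescaled_measure R \<nu> =
     density \<nu> (\<lambda>x. inverse (truncated_moment R \<nu>) * min R (ennreal (norm x)))"

definition open_cone :: "'a::real_vector set \<Rightarrow> 'a set" where
  "open_cone E = {r *\<^sub>R e | r e. 0 < r \<and> e \<in> E}"

abbreviation sphere_borel :: "'a::euclidean_space measure" where
  "sphere_borel \<equiv> restrict_space borel (sphere 0 1)"

definition angular_measure :: "'a::euclidean_space measure \<Rightarrow> 'a measure" where
  "angular_measure M =
     measure_of (sphere 0 1) (sets sphere_borel) (\<lambda>E. emeasure M (open_cone E))"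

definition weak_limit :: "(nat \<Rightarrow> 'a::topological_space measure) \<Rightarrow> 'a measure \<Rightarrow> bool" where
  "weak_limit M N \<longleftrightarrow>
     (\<forall>g :: 'a \<Rightarrow> real. continuous_on (space N) g \<longrightarrow> bounded (g ` space N) \<longrightarrow>
        (\<lambda>j. \<integral>x. g x \<partial>M j) \<longlonglongrightarrow> (\<integral>x. g x \<partial>N))"

lemma open_cone_eq:
  assumes "E \<subseteq> sphere 0 (1::real)"
  shows "open_cone E = {x::'a::euclidean_space. x \<noteq> 0 \<and> x /\<^sub>R norm x \<in> E}"
proof (intro set_eqI iffI)
  fix x :: 'a assume "x \<in> open_cone E"
  then obtain r e where "x = r *\<^sub>R e" "0 < r" "e \<in> E" by (auto simp: open_cone_def)
  moreover have "norm e = 1" using assms \<open>e \<in> E\<close> by auto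
  ultimately show "x \<in> {x. x \<noteq> 0 \<and> x /\<^sub>R norm x \<in> E}" by auto
next
  fix x :: 'a assume x: "x \<in> {x. x \<noteq> 0 \<and> x /\<^sub>R norm x \<in> E}"
  then have "x = norm x *\<^sub>R (x /\<^sub>R norm x)" by simp
  with x show "x \<in> open_cone E" unfolding open_cone_def
    by (smt (verit) mem_Collect_eq zero_less_norm_iff)
qed

lemma emeasure_angular_measure:
  fixes M :: "'a::euclidean_space measure"
  assumes "sets M = sets borel" and E: "E \<in> sets sphere_borel"
  shows "emeasure (angular_measure M) E = emeasure M (open_cone E)"
proof -
  have meas: "open_cone E \<in> sets M" if "E \<in> sets sphere_borel" for E :: "'a set"
  proof -
    from that have sub: "E \<subseteq> sphere 0 1" and bor: "E \<in> sets borel"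
      by (auto simp: sets_restrict_space_iff)
    have [measurable]: "E \<in> sets borel" by (fact bor)
    have "{x::'a \<in> space borel. x \<noteq> 0 \<and> x /\<^sub>R norm x \<in> E} \<in> sets borel" by measurable
    then show ?thesis using assms(1) by (simp add: open_cone_eq[OF sub])
  qed
  have "countably_additive (sets sphere_borel) (\<lambda>E. emeasure M (open_cone E))"
  proof (rule countably_additiveI)
    fix A :: "nat \<Rightarrow> 'a set"
    assume A: "range A \<subseteq> sets sphere_borel" "disjoint_family A" "(\<Union>i. A i) \<in> sets sphere_borel"
    have sub: "A i \<subseteq> sphere 0 1" for i
      using A(1) sets.sets_into_space[of "A i" sphere_borel] by (auto simp: space_restrict_space)
    have "disjoint_family (\<lambda>i. open_cone (A i))"
      using A(2) unfolding disjoint_family_on_def open_cone_eq[OF sub] by blast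
    moreover have "open_cone (\<Union>i. A i) = (\<Union>i. open_cone (A i))"
      unfolding open_cone_def by blast
    ultimately show "(\<Sum>i. emeasure M (open_cone (A i))) = emeasure M (open_cone (\<Union>i. A i))"
      using A(1) meas by (subst suminf_emeasure) auto
  qed
  moreover have "positive (sets sphere_borel) (\<lambda>E. emeasure M (open_cone E))"
    by (simp add: positive_def open_cone_def)
  moreover have "sigma_algebra (sphere 0 1) (sets (sphere_borel :: 'a measure))"
    using sets.sigma_algebra_axioms[of "sphere_borel :: 'a measure"]
    by (simp add: space_restrict_space)
  ultimately show ?thesis
    unfolding angular_measure_def by (intro emeasure_measure_of_sigma) (use E in auto)
qed

end

theory Submission
  imports Defs
begin

text \<open>Write \<open>\<phi>(x) = \<parallel>f(\<cdot> + x) - f\<parallel>\<close> for the \<open>L\<^sup>1\<close> distance of \<open>f\<close> to its translate and \<open>V(x)\<close> for the total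
  variation of \<open>Df \<cdot> x\<close>. For a test function \<open>\<psi>\<close> with \<open>\<bar>\<psi>\<bar> \<le> 1\<close>, the function
  \<open>F(t) = \<integral> f(y) \<psi>(y - t x) dy\<close> has derivative \<open>\<integral> \<psi>(y - t x) (Df \<cdot> x)(dy)\<close>. Optimising over \<open>\<psi>\<close>, the mean
  value theorem gives \<open>\<phi> \<le> V\<close> and the derivative at \<open>0\<close> gives \<open>liminf \<phi>(t x) / t \<ge> V(x)\<close>. Since \<open>\<phi>\<close> and
  \<open>V\<close> are subadditive and Lipschitz, \<open>\<phi>(t \<theta>) / t \<rightarrow> V(\<theta>)\<close> uniformly on the sphere. By Tonelli,
  the rescaled energy is half the integral of \<open>\<phi>(x) / (R \<and> \<bar>x\<bar>)\<close> against the rescaled measure, which by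
  concentration at the origin differs from the integral of \<open>V\<close> against the angular measure by an error
  tending to \<open>0\<close>; the latter converges along a weakly convergent subsequence. Weak compactness on the sphere is
  reduced to Helly's theorem on the line by transport along a space-filling curve with a measurable
  section.\<close>

subsection \<open>Total variation of vector measures\<close>

text \<open>The lower bound in a fixed direction holds only below a threshold that depends on the
  direction, while the rescaled measures charge all directions at once; hence the need for
  uniformity, and hence both functions are studied on all vectors, where subadditivity and
  homogeneity make sense. The two optimisations over test functions are instances of one duality
  estimate for a pair of finite measures: the Jordan parts of the directional derivative, or the
  positive and negative parts of the difference of translates as densities. The gradient is tested
  in basis directions only, so reaching an arbitrary direction requires linearity of the signed
  integral in the measure, which the Jordan parts hide. Smooth functions are produced by
  Stone-Weierstrass and a bump, in place of mollification. In the transport to the line only the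
  curve has to be continuous, since limits are tested with functions composed with it; the section
  merely carries measures to the line. The subsequence is chosen before any function of bounded
  variation enters, and weak convergence then serves all of them.\<close>

lemma vector_measure_sums:
  assumes "vector_measure m" "\<And>n::nat. A n \<in> sets borel" "disjoint_family A"
  shows "(\<lambda>n. m (A n)) sums m (\<Union>n. A n)"
  using assms unfolding vector_measure_def by blast

lemma suminf_le_variation:
  assumes "\<And>n::nat. A n \<in> sets borel" "disjoint_family A"
  shows "(\<Sum>n. ennreal (norm (m (A n)))) \<le> variation m (\<Union>n. A n)"
  unfolding variation_def using assms by (intro SUP_upper) auto

lemma norm_le_variation:
  assumes "vector_measure m" "E \<in> sets borel"
  shows "ennreal (norm (m E)) \<le> variation m E"
proof -
  have m0: "m {} = 0" using assms by (simp add: vector_measure_def)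
  have "(\<Sum>n. ennreal (norm (m (binaryset E {} n)))) \<le> variation m (\<Union>n. binaryset E {} n)"
    using assms by (intro suminf_le_variation) (auto simp: binaryset_def disjoint_family_on_def)
  moreover have "(\<lambda>n. ennreal (norm (m (binaryset E {} n)))) sums (ennreal (norm (m E)) + ennreal (norm (m {})))"
    by (intro binaryset_sums) (simp add: m0)
  ultimately show ?thesis by (simp add: UN_binaryset_eq sums_unique[symmetric] m0)
qed

lemma variation_least:
  assumes "\<And>A :: nat \<Rightarrow> _. (\<And>n. A n \<in> sets borel) \<Longrightarrow> disjoint_family A \<Longrightarrow> (\<Union>n. A n) = E \<Longrightarrow>
    (\<Sum>n. ennreal (norm (m (A n)))) \<le> c"
  shows "variation m E \<le> c"
  unfolding variation_def using assms by (intro SUP_least) auto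

lemma ennreal_norm_sums_le:
  assumes "f sums (s::'a::real_normed_vector)"
  shows "ennreal (norm s) \<le> (\<Sum>n. ennreal (norm (f n)))"
proof -
  have "(\<lambda>n. ennreal (norm (\<Sum>i<n. f i))) \<longlonglongrightarrow> ennreal (norm s)"
    using assms unfolding sums_def by (intro tendsto_ennrealI tendsto_norm)
  moreover have "(\<lambda>n. \<Sum>i<n. ennreal (norm (f i))) \<longlonglongrightarrow> (\<Sum>n. ennreal (norm (f n)))"
    by (rule summable_LIMSEQ) simp
  moreover have "ennreal (norm (\<Sum>i<n. f i)) \<le> (\<Sum>i<n. ennreal (norm (f i)))" for n
    by (subst sum_ennreal) (auto intro!: ennreal_leI norm_sum)
  ultimately show ?thesis by (meson LIMSEQ_le)
qed

lemma suminf_ennreal_swap: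
  fixes f :: "nat \<Rightarrow> nat \<Rightarrow> ennreal"
  shows "(\<Sum>i. \<Sum>j. f i j) = (\<Sum>j. \<Sum>i. f i j)"
proof -
  have "(\<Sum>i. \<Sum>j. f i j) = (\<integral>\<^sup>+i. (\<Sum>j. f i j) \<partial>count_space UNIV)"
    by (simp add: nn_integral_count_space_nat)
  also have "\<dots> = (\<Sum>j. \<integral>\<^sup>+i. f i j \<partial>count_space UNIV)"
    by (rule nn_integral_suminf) simp
  finally show ?thesis by (simp add: nn_integral_count_space_nat)
qed

text \<open>For the upper bound a partition of the union is cut along the \<open>E n\<close> and the
  two sums are exchanged. For the lower bound near-optimal partitions of the single
  \<open>E n\<close>, with errors that add up to \<open>\<epsilon>\<close>, are joined into one
  partition of the union.\<close>

lemma variation_countably_additive: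
  assumes m: "vector_measure m" and E: "\<And>n::nat. E n \<in> sets borel" "disjoint_family E"
  shows "variation m (\<Union>n. E n) = (\<Sum>n. variation m (E n))"
proof (rule antisym)
  show "variation m (\<Union>n. E n) \<le> (\<Sum>n. variation m (E n))"
  proof (rule variation_least)
    fix A :: "nat \<Rightarrow> 'a set"
    assume A: "\<And>n. A n \<in> sets borel" "disjoint_family A" "(\<Union>n. A n) = (\<Union>n. E n)"
    have "ennreal (norm (m (A k))) \<le> (\<Sum>n. ennreal (norm (m (A k \<inter> E n))))" for k
    proof -
      have "(\<lambda>n. m (A k \<inter> E n)) sums m (\<Union>n. A k \<inter> E n)"
        using E A(1) by (intro vector_measure_sums m) (auto simp: disjoint_family_on_def)
      moreover have "(\<Union>n. A k \<inter> E n) = A k" using A(3) by blast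
      ultimately show ?thesis using ennreal_norm_sums_le by metis
    qed
    then have "(\<Sum>k. ennreal (norm (m (A k)))) \<le> (\<Sum>k. \<Sum>n. ennreal (norm (m (A k \<inter> E n))))"
      by (intro suminf_le) auto
    also have "\<dots> = (\<Sum>n. \<Sum>k. ennreal (norm (m (A k \<inter> E n))))"
      by (rule suminf_ennreal_swap)
    also have "\<dots> \<le> (\<Sum>n. variation m (E n))"
    proof (rule suminf_le)
      fix n
      have "(\<Sum>k. ennreal (norm (m (A k \<inter> E n)))) \<le> variation m (\<Union>k. A k \<inter> E n)"
        using A E(1) by (intro suminf_le_variation) (auto simp: disjoint_family_on_def)
      moreover have "(\<Union>k. A k \<inter> E n) = E n" using A(3) by blast
      ultimately show "(\<Sum>k. ennreal (norm (m (A k \<inter> E n)))) \<le> variation m (E n)" by simp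
    qed auto
    finally show "(\<Sum>k. ennreal (norm (m (A k)))) \<le> (\<Sum>n. variation m (E n))" .
  qed
  have ne: "{A :: nat \<Rightarrow> 'a set. range A \<subseteq> sets borel \<and> disjoint_family A \<and> (\<Union>n. A n) = F} \<noteq> {}"
    if "F \<in> sets borel" for F
  proof -
    have "binaryset F {} \<in> {A :: nat \<Rightarrow> 'a set. range A \<subseteq> sets borel \<and> disjoint_family A \<and> (\<Union>n. A n) = F}"
      using that by (simp add: UN_binaryset_eq) (auto simp: binaryset_def disjoint_family_on_def)
    then show ?thesis by blast
  qed
  show "(\<Sum>n. variation m (E n)) \<le> variation m (\<Union>n. E n)"
  proof (cases "\<exists>n. variation m (E n) = \<infinity>")
    case True
    then obtain n where n: "variation m (E n) = \<infinity>" by blast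
    \<comment> \<open>If one piece has infinite variation, comparison with that piece alone
      suffices. Monotonicity is proved by hand because \<open>variation_mono\<close> rests on the
      present lemma.\<close>
    have "variation m (E n) \<le> variation m (\<Union>n. E n)"
    proof (rule variation_least)
      fix A :: "nat \<Rightarrow> 'a set"
      assume A: "\<And>k. A k \<in> sets borel" "disjoint_family A" "(\<Union>k. A k) = E n"
      \<comment> \<open>The rest of the union occupies index 0 and shifts \<open>A\<close> by one,
        so dropping the first term recovers the sum over \<open>A\<close>.\<close>
      define B where "B k = (case k of 0 \<Rightarrow> (\<Union>n. E n) - E n | Suc k \<Rightarrow> A k)" for k
      have "(\<Sum>k. ennreal (norm (m (A k)))) = (\<Sum>k. ennreal (norm (m (B (k + 1)))))"
        by (simp add: B_def)
      also have "\<dots> \<le> (\<Sum>k. ennreal (norm (m (B k))))"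
        by (subst suminf_offset[of "\<lambda>k. ennreal (norm (m (B k)))" 1]) auto
      also have "\<dots> \<le> variation m (\<Union>k. B k)"
      proof (rule suminf_le_variation)
        show "B k \<in> sets borel" for k using A(1) E(1) by (auto simp: B_def split: nat.split)
        have "A k \<subseteq> E n" for k using A(3) by blast
        then show "disjoint_family B"
          using A(2) unfolding disjoint_family_on_def B_def
          by (auto split: nat.split)
      qed
      also have "(\<Union>k. B k) = (\<Union>n. E n)"
      proof (intro equalityI subsetI)
        fix x assume "x \<in> (\<Union>k. B k)"
        then obtain k where "x \<in> B k" by blast
        then show "x \<in> (\<Union>n. E n)" using A(3) by (cases k) (auto simp: B_def)
      next
        fix x assume x: "x \<in> (\<Union>n. E n)"
        show "x \<in> (\<Union>k. B k)"
        proof (cases "x \<in> E n")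
          case True
          then obtain k where "x \<in> A k" using A(3) by blast
          then have "x \<in> B (Suc k)" by (simp add: B_def)
          then show ?thesis by blast
        next
          case False
          then have "x \<in> B 0" using x by (simp add: B_def)
          then show ?thesis by blast
        qed
      qed
      finally show "(\<Sum>k. ennreal (norm (m (A k)))) \<le> variation m (\<Union>n. E n)" .
    qed
    then show ?thesis using n by (simp add: top_unique)
  next
    case False
    show ?thesis
    proof (rule ennreal_le_epsilon)
      fix \<epsilon> :: real assume "0 < \<epsilon>"
      have "\<exists>A :: nat \<Rightarrow> 'a set. range A \<subseteq> sets borel \<and> disjoint_family A \<and> (\<Union>k. A k) = E n \<and>
         variation m (E n) \<le> (\<Sum>k. ennreal (norm (m (A k)))) + ennreal (\<epsilon> * (1/2)^Suc n)" for n
      \<comment> \<open>Subtraction in \<open>ennreal\<close> is truncated at 0, so a supremum equal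
        to 0 has nothing strictly below it; in that case any partition will do.\<close>
      proof (cases "variation m (E n) = 0")
        case True
        then show ?thesis using ne[OF E(1)[of n]] by auto
      next
        case nz: False
        have "variation m (E n) - ennreal (\<epsilon> * (1/2)^Suc n) < variation m (E n)"
        proof (rule ennreal_between)
          show "variation m (E n) < \<top>" using False less_top by auto
          show "0 < variation m (E n)" using nz zero_less_iff_neq_zero by blast
        qed (use \<open>0 < \<epsilon>\<close> in simp)
        then obtain A where A: "range A \<subseteq> sets borel" "disjoint_family A" "(\<Union>k. A k) = E n"
           "variation m (E n) - ennreal (\<epsilon> * (1/2)^Suc n) < (\<Sum>k. ennreal (norm (m (A k))))"
          unfolding variation_def[of m "E n"] less_SUP_iff by auto
        from less_imp_le[OF A(4)] have "variation m (E n) \<le> (\<Sum>k. ennreal (norm (m (A k)))) + ennreal (\<epsilon> * (1/2)^Suc n)"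
          by (simp add: ennreal_minus_le_iff add.commute)
        then show ?thesis using A by blast
      qed
      then obtain A :: "nat \<Rightarrow> nat \<Rightarrow> 'a set" where A: "\<And>n. range (A n) \<subseteq> sets borel"
         "\<And>n. disjoint_family (A n)" "\<And>n. (\<Union>k. A n k) = E n"
         "\<And>n. variation m (E n) \<le> (\<Sum>k. ennreal (norm (m (A n k)))) + ennreal (\<epsilon> * (1/2)^Suc n)"
        by metis
      \<comment> \<open>The doubly indexed pieces are listed in one sequence by the pairing of
        natural numbers.\<close>
      define B where "B i = case_prod A (prod_decode i)" for i
      have "(\<Sum>n. variation m (E n)) \<le>
          (\<Sum>n. (\<Sum>k. ennreal (norm (m (A n k)))) + ennreal (\<epsilon> * (1/2)^Suc n))"
        by (intro suminf_le A) auto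
      also have "\<dots> = (\<Sum>n. \<Sum>k. ennreal (norm (m (A n k)))) + (\<Sum>n. ennreal (\<epsilon> * (1/2)^Suc n))"
        by (rule suminf_add[symmetric]) auto
      also have "(\<Sum>n. ennreal (\<epsilon> * (1/2)^Suc n)) = ennreal \<epsilon>"
        using sums_mult[OF power_half_series, of \<epsilon>] \<open>0 < \<epsilon>\<close>
        by (intro suminf_ennreal_eq) auto
      also have "(\<Sum>n. \<Sum>k. ennreal (norm (m (A n k)))) = (\<Sum>i. ennreal (norm (m (B i))))"
      proof -
        have "(\<Sum>i. (\<lambda>(n,k). ennreal (norm (m (A n k)))) (prod_decode i)) = (\<Sum>n. \<Sum>k. ennreal (norm (m (A n k))))"
          by (rule suminf_ennreal_2dimen) simp
        then show ?thesis by (simp add: B_def case_prod_unfold)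
      qed
      also have "\<dots> \<le> variation m (\<Union>i. B i)"
      proof (rule suminf_le_variation)
        show "B i \<in> sets borel" for i using A(1) by (auto simp: B_def split: prod.split)
        show "disjoint_family B"
          unfolding disjoint_family_on_def
        proof (intro ballI impI)
          fix i j :: nat assume "i \<noteq> j"
          obtain a b c d where ab: "prod_decode i = (a,b)" and cd: "prod_decode j = (c,d)" by fastforce
          have ne: "(a,b) \<noteq> (c,d)" using \<open>i \<noteq> j\<close> ab cd by (metis prod_decode_inverse)
          have "A a b \<inter> A c d = {}"
          proof (cases "a = c")
            case True
            then show ?thesis using ne A(2)[of a] by (auto simp: disjoint_family_on_def)
          next
            case False
            moreover have "A a b \<subseteq> E a" "A c d \<subseteq> E c" using A(3) by blast+
            ultimately show ?thesis using E(2) unfolding disjoint_family_on_def by blast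
          qed
          then show "B i \<inter> B j = {}" by (simp add: B_def ab cd)
        qed
      qed
      also have "(\<Union>i. B i) = (\<Union>n. E n)"
      proof -
        have "(\<Union>i. B i) = \<Union> (case_prod A ` range prod_decode)"
          unfolding B_def image_image ..
        also have "\<dots> = (\<Union>p. case_prod A p)" by (simp add: surj_prod_decode)
        also have "\<dots> = (\<Union>n. \<Union>k. A n k)" by auto
        finally show ?thesis using A(3) by simp
      qed
      finally show "(\<Sum>n. variation m (E n)) \<le> variation m (\<Union>n. E n) + ennreal \<epsilon>" 
        by (simp add: add_right_mono)
    qed
  qed
qed

lemma variation_mono:
  assumes m: "vector_measure m" and "E \<in> sets borel" "F \<in> sets borel" "E \<subseteq> F"
  shows "variation m E \<le> variation m F"
proof -
  have "variation m (\<Union>n. binaryset E (F - E) n) = (\<Sum>n. variation m (binaryset E (F - E) n))"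
    using assms by (intro variation_countably_additive) (auto simp: binaryset_def disjoint_family_on_def)
  also have "variation m E \<le> (\<Sum>n. variation m (binaryset E (F - E) n))"
    using sum_le_suminf[of "\<lambda>n. variation m (binaryset E (F - E) n)" "{0}"]
    by (simp add: binaryset_def)
  finally show ?thesis using assms(4) by (simp add: UN_binaryset_eq Un_absorb1)
qed

lemma variation_empty: "vector_measure m \<Longrightarrow> variation m {} = 0"
  by (rule antisym, rule variation_least) (auto simp: vector_measure_def)

subsection \<open>Jordan parts and signed integrals\<close>

text \<open>Shared by the two Jordan parts: their set functions involve differences, so countable
  additivity is checked in the reals and only then transferred to \<open>ennreal\<close>.\<close>

lemma emeasure_measure_of_real:
  fixes g :: "'a::topological_space set \<Rightarrow> real"
  assumes nn: "\<And>A. A \<in> sets borel \<Longrightarrow> 0 \<le> g A" and "g {} = 0"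
    and g: "\<And>A :: nat \<Rightarrow> 'a set. (\<And>n. A n \<in> sets borel) \<Longrightarrow> disjoint_family A \<Longrightarrow>
      (\<lambda>n. g (A n)) sums g (\<Union>n. A n)"
    and A: "A \<in> sets borel"
  shows "emeasure (measure_of UNIV (sets borel) (\<lambda>A. ennreal (g A))) A = ennreal (g A)"
proof (rule emeasure_measure_of_sigma)
  show "sigma_algebra UNIV (sets (borel::'a measure))"
    using sets.sigma_algebra_axioms[of "borel :: 'a measure"] by simp
  show "countably_additive (sets (borel::'a measure)) (\<lambda>A. ennreal (g A))"
  proof (rule countably_additiveI)
    fix A :: "nat \<Rightarrow> 'a set"
    assume A: "range A \<subseteq> sets borel" "disjoint_family A"
    have "(\<lambda>n. g (A n)) sums g (\<Union>n. A n)" using A by (intro g) auto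
    then show "(\<Sum>i. ennreal (g (A i))) = ennreal (g (\<Union>i. A i))"
      using A nn by (intro suminf_ennreal_eq) auto
  qed
qed (use assms in \<open>auto simp: positive_def\<close>)

context
  fixes s :: "'a::topological_space set \<Rightarrow> real"
  assumes s: "vector_measure s" and fin: "variation s UNIV < \<infinity>"
begin

lemma ennreal_enn2real_variation:
  assumes "A \<in> sets borel" shows "ennreal (enn2real (variation s A)) = variation s A"
proof -
  have "variation s A < \<infinity>" using le_less_trans[OF variation_mono[OF s assms _ subset_UNIV] fin] by simp
  then show ?thesis by simp
qed

lemma abs_le_enn2real_variation:
  assumes "A \<in> sets borel" shows "\<bar>s A\<bar> \<le> enn2real (variation s A)"
  using norm_le_variation[OF s assms] ennreal_enn2real_variation[OF assms]
  by (metis ennreal_le_iff enn2real_nonneg real_norm_def)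

lemma enn2real_variation_sums:
  assumes A: "\<And>n::nat. A n \<in> sets borel" "disjoint_family A"
  shows "(\<lambda>n. enn2real (variation s (A n))) sums enn2real (variation s (\<Union>n. A n))"
proof -
  have "(\<Sum>n. ennreal (enn2real (variation s (A n)))) = variation s (\<Union>n. A n)"
    using variation_countably_additive[OF s A] A(1) by (simp add: ennreal_enn2real_variation)
  moreover have "\<dots> = ennreal (enn2real (variation s (\<Union>n. A n)))"
    using A(1) by (simp add: ennreal_enn2real_variation)
  moreover have "\<dots> \<noteq> \<top>" by simp
  ultimately show ?thesis
    by (intro sums_ennreal[THEN iffD1]) (auto simp: sums_iff)
qed

lemma emeasure_jordan_pos:
  assumes "A \<in> sets borel"
  shows "emeasure (jordan_pos s) A = ennreal ((enn2real (variation s A) + s A) / 2)"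
  unfolding jordan_pos_def
proof (rule emeasure_measure_of_real)
  show "0 \<le> (enn2real (variation s A) + s A) / 2" if "A \<in> sets borel" for A
    using abs_le_enn2real_variation[OF that] by (simp add: abs_le_iff)
  show "(enn2real (variation s {}) + s {}) / 2 = 0"
    using s by (simp add: variation_empty vector_measure_def)
qed (use assms in \<open>auto intro!: sums_divide sums_add enn2real_variation_sums vector_measure_sums s\<close>)

lemma emeasure_jordan_neg:
  assumes "A \<in> sets borel"
  shows "emeasure (jordan_neg s) A = ennreal ((enn2real (variation s A) - s A) / 2)"
  unfolding jordan_neg_def
proof (rule emeasure_measure_of_real)
  show "0 \<le> (enn2real (variation s A) - s A) / 2" if "A \<in> sets borel" for A
    using abs_le_enn2real_variation[OF that] by (simp add: abs_le_iff)
  show "(enn2real (variation s {}) - s {}) / 2 = 0"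
    using s by (simp add: variation_empty vector_measure_def)
qed (use assms in \<open>auto intro!: sums_divide sums_diff enn2real_variation_sums vector_measure_sums s\<close>)

lemma sets_jordan [simp]: "sets (jordan_pos s) = sets borel" "sets (jordan_neg s) = sets borel"
  unfolding jordan_pos_def jordan_neg_def
  using sets.sigma_sets_eq[of "borel :: 'a measure"] by (simp_all add: sets_measure_of_conv)

lemma space_jordan [simp]: "space (jordan_pos s) = UNIV" "space (jordan_neg s) = UNIV"
  unfolding jordan_pos_def jordan_neg_def by (simp_all add: space_measure_of_conv)

lemma finite_measure_jordan: "finite_measure (jordan_pos s)" "finite_measure (jordan_neg s)"
  by (auto intro!: finite_measureI simp: emeasure_jordan_pos emeasure_jordan_neg)

lemma measure_jordan:
  assumes "A \<in> sets borel"
  shows "measure (jordan_pos s) A = (enn2real (variation s A) + s A) / 2"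
    and "measure (jordan_neg s) A = (enn2real (variation s A) - s A) / 2"
  using abs_le_enn2real_variation[OF assms] emeasure_jordan_pos[OF assms] emeasure_jordan_neg[OF assms]
  by (auto simp: measure_def abs_le_iff)

end

text \<open>The sum is the integral of \<open>g\<close> rounded down to a multiple of
  \<open>h\<close>, which changes \<open>g\<close> by at most \<open>h\<close> at each point.
  Rounding down can leave the interval from \<open>- B / h\<close> to \<open>B / h\<close> by up to
  1, whence the margin in the condition on \<open>K\<close>.\<close>

lemma (in finite_measure) integral_level_set_approx:
  fixes g :: "'a \<Rightarrow> real" and K :: int
  assumes [measurable]: "g \<in> borel_measurable M" and B: "\<And>x. \<bar>g x\<bar> \<le> B"
    and h: "0 < h" and K: "B / h + 1 \<le> of_int K"
  shows "\<bar>(\<integral>x. g x \<partial>M) - (\<Sum>k\<in>{-K..K}. of_int k * h * measure M {x \<in> space M. \<lfloor>g x / h\<rfloor> = k})\<bar>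
    \<le> h * measure M (space M)"
proof -
  let ?A = "\<lambda>k. {x \<in> space M. \<lfloor>g x / h\<rfloor> = k}"
  define T where "T x = h * of_int \<lfloor>g x / h\<rfloor>" for x
  have A[measurable]: "?A k \<in> sets M" for k by measurable
  have T_eq: "T x = (\<Sum>k\<in>{-K..K}. of_int k * h * indicator (?A k) x)" if "x \<in> space M" for x
  proof -
    have "g x / h \<le> B / h" "- (B / h) \<le> g x / h"
      using B[of x] h by (simp_all add: abs_le_iff field_simps)
    then have "\<lfloor>g x / h\<rfloor> \<in> {-K..K}"
      using K by (auto simp: le_floor_iff floor_le_iff)
    then have "(\<Sum>k\<in>{-K..K}. of_int k * h * indicator (?A k) x) =
        (\<Sum>k\<in>{-K..K}. if k = \<lfloor>g x / h\<rfloor> then of_int k * h else 0)"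
      using that by (intro sum.cong) (auto simp: indicator_def)
    also have "\<dots> = T x" using \<open>\<lfloor>g x / h\<rfloor> \<in> {-K..K}\<close> by (simp add: T_def)
    finally show ?thesis ..
  qed
  have close: "\<bar>g x - T x\<bar> \<le> h" for x
  proof -
    have "h * of_int \<lfloor>g x / h\<rfloor> \<le> h * (g x / h)" "h * (g x / h) \<le> h * (of_int \<lfloor>g x / h\<rfloor> + 1)"
      using h by (intro mult_left_mono; linarith)+
    then show ?thesis using h by (simp add: T_def abs_le_iff algebra_simps)
  qed
  have intg: "integrable M g" by (rule integrable_const_bound[of _ B]) (use B in auto)
  have [measurable]: "T \<in> borel_measurable M" unfolding T_def by measurable
  have intT: "integrable M T"
  proof (rule integrable_const_bound[of _ "B + h"])
    show "AE x in M. norm (T x) \<le> B + h"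
    proof (rule AE_I2)
      show "norm (T x) \<le> B + h" for x
        using close[of x] B[of x] by (simp add: abs_le_iff)
    qed
  qed simp
  have "(\<integral>x. T x \<partial>M) = (\<integral>x. (\<Sum>k\<in>{-K..K}. of_int k * h * indicator (?A k) x) \<partial>M)"
    by (intro Bochner_Integration.integral_cong refl) (rule T_eq)
  also have "\<dots> = (\<Sum>k\<in>{-K..K}. of_int k * h * measure M (?A k))"
    by (subst Bochner_Integration.integral_sum) (auto simp: less_top[symmetric] Int_absorb2 subset_iff)
  finally have eq: "(\<integral>x. T x \<partial>M) = \<dots>" .
  have "\<bar>(\<integral>x. g x \<partial>M) - (\<integral>x. T x \<partial>M)\<bar> = \<bar>\<integral>x. g x - T x \<partial>M\<bar>"
    using intg intT by simp
  also have "\<dots> \<le> (\<integral>x. \<bar>g x - T x\<bar> \<partial>M)" by simp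
  also have "\<dots> \<le> (\<integral>x. h \<partial>M)"
    using intg intT close by (intro integral_mono) auto
  finally show ?thesis by (simp add: eq mult.commute)
qed

section \<open>Bounds and linearity of the signed integral\<close>

lemma integral_abs_bound_finite:
  fixes g :: "'a \<Rightarrow> real"
  assumes "finite_measure M" "\<And>x. \<bar>g x\<bar> \<le> B"
  shows "\<bar>\<integral>x. g x \<partial>M\<bar> \<le> B * measure M (space M)"
proof -
  interpret finite_measure M by fact
  have "0 \<le> B" using assms(2)[of undefined] by simp
  show ?thesis
  \<comment> \<open>Nothing is assumed about measurability of \<open>g\<close>: a nonintegrable
    function has integral 0 by convention, and the bound survives.\<close>
  proof (cases "integrable M g")
    case True
    have "\<bar>\<integral>x. g x \<partial>M\<bar> \<le> (\<integral>x. \<bar>g x\<bar> \<partial>M)" by simp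
    also have "\<dots> \<le> (\<integral>x. B \<partial>M)" using True assms(2) by (intro integral_mono) auto
    finally show ?thesis by (simp add: mult.commute)
  qed (use \<open>0 \<le> B\<close> in \<open>simp add: not_integrable_integral_eq\<close>)
qed

lemma signed_integral_bound:
  assumes s: "vector_measure s" "variation s UNIV < \<infinity>" and B: "\<And>x. \<bar>g x\<bar> \<le> B"
  shows "\<bar>signed_integral s g\<bar> \<le> B * enn2real (variation s UNIV)"
proof -
  have "B * measure (jordan_pos s) UNIV + B * measure (jordan_neg s) UNIV = B * enn2real (variation s UNIV)"
    by (simp add: measure_jordan[OF s] field_simps)
  moreover have "\<bar>integral\<^sup>L (jordan_pos s) g\<bar> \<le> B * measure (jordan_pos s) UNIV"
    using integral_abs_bound_finite[OF finite_measure_jordan(1)[OF s], of g B, OF B] by (simp add: space_jordan[OF s])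
  moreover have "\<bar>integral\<^sup>L (jordan_neg s) g\<bar> \<le> B * measure (jordan_neg s) UNIV"
    using integral_abs_bound_finite[OF finite_measure_jordan(2)[OF s], of g B, OF B] by (simp add: space_jordan[OF s])
  ultimately show ?thesis unfolding signed_integral_def by linarith
qed

text \<open>Here \<open>g\<close> is rounded down to multiples of \<open>1 / Suc n\<close>, and
  \<open>B\<close> stands for a bound of \<open>\<bar>g\<bar>\<close>, which makes the range of
  \<open>k\<close> finite.\<close>

definition level_sum :: "('a \<Rightarrow> real) \<Rightarrow> real \<Rightarrow> ('a set \<Rightarrow> real) \<Rightarrow> nat \<Rightarrow> real" where
  "level_sum g B s n = (let K = \<lceil>B * real (Suc n) + 1\<rceil> in
     \<Sum>k\<in>{-K..K}. of_int k / real (Suc n) * s {x. \<lfloor>g x * real (Suc n)\<rfloor> = k})"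

text \<open>The level sets of the integrand do not depend on the measure, so this limit exhibits the
  integral as linear in the signed measure.\<close>

lemma level_sum_tendsto:
  assumes s: "vector_measure s" "variation s UNIV < \<infinity>"
    and g[measurable]: "g \<in> borel_measurable borel" and B: "\<And>x. \<bar>g x\<bar> \<le> B"
  shows "level_sum g B s \<longlonglongrightarrow> signed_integral s g"
proof (rule LIM_zero_cancel, rule Lim_null_comparison)
  let ?V = "enn2real (variation s UNIV)"
  have [measurable]: "g \<in> borel_measurable (jordan_pos s)" "g \<in> borel_measurable (jordan_neg s)"
    using s by (simp_all cong: measurable_cong_sets)
  show "\<forall>\<^sub>F n in sequentially. norm (level_sum g B s n - signed_integral s g) \<le> ?V * inverse (real (Suc n))"
  proof (rule always_eventually, rule allI)
    fix n
    define h where "h = inverse (real (Suc n))"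
    have h: "0 < h" by (simp add: h_def)
    define K where "K = \<lceil>B * real (Suc n) + 1\<rceil>"
    have K: "B / h + 1 \<le> of_int K" unfolding K_def h_def by (simp add: field_simps)
    let ?A = "\<lambda>k. {x. \<lfloor>g x / h\<rfloor> = k}"
    have A[measurable]: "?A k \<in> sets borel" for k by measurable
    have "level_sum g B s n = (\<Sum>k\<in>{-K..K}. of_int k * h * s (?A k))"
      unfolding level_sum_def Let_def K_def[symmetric] by (simp add: h_def divide_inverse)
    also have "\<dots> = (\<Sum>k\<in>{-K..K}. of_int k * h * measure (jordan_pos s) (?A k)) -
        (\<Sum>k\<in>{-K..K}. of_int k * h * measure (jordan_neg s) (?A k))"
      unfolding sum_subtractf[symmetric]
      by (intro sum.cong refl) (simp add: measure_jordan[OF s A] field_simps)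
    finally have eq: "level_sum g B s n = \<dots>" .
    have "norm (level_sum g B s n - signed_integral s g) \<le> h * measure (jordan_pos s) UNIV + h * measure (jordan_neg s) UNIV"
      using finite_measure.integral_level_set_approx[OF finite_measure_jordan(1)[OF s], of g B h K, OF _ B h K]
        finite_measure.integral_level_set_approx[OF finite_measure_jordan(2)[OF s], of g B h K, OF _ B h K]
      unfolding eq signed_integral_def by (simp add: space_jordan[OF s])
    also have "\<dots> = ?V * h" by (simp add: measure_jordan[OF s] field_simps)
    finally show "norm (level_sum g B s n - signed_integral s g) \<le> ?V * inverse (real (Suc n))"
      by (simp add: h_def)
  qed
  show "(\<lambda>n. ?V * inverse (real (Suc n))) \<longlonglongrightarrow> 0"
    using tendsto_mult[OF tendsto_const LIMSEQ_inverse_real_of_nat] by simp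
qed

text \<open>The Jordan parts of a combination are not the combinations of the Jordan parts. For
  fixed \<open>g\<close>, \<open>B\<close> and \<open>n\<close>, however, \<open>level_sum\<close>
  is linear in the set function, and linearity passes to the limit.\<close>

lemma signed_integral_linear_combination:
  fixes s :: "'i \<Rightarrow> 'a::topological_space set \<Rightarrow> real"
  assumes s: "\<And>i. i \<in> I \<Longrightarrow> vector_measure (s i)" "\<And>i. i \<in> I \<Longrightarrow> variation (s i) UNIV < \<infinity>"
    and s': "vector_measure (\<lambda>A. \<Sum>i\<in>I. c i * s i A)" "variation (\<lambda>A. \<Sum>i\<in>I. c i * s i A) UNIV < \<infinity>"
    and g: "g \<in> borel_measurable borel" "\<And>x. \<bar>g x\<bar> \<le> B"
  shows "signed_integral (\<lambda>A. \<Sum>i\<in>I. c i * s i A) g = (\<Sum>i\<in>I. c i * signed_integral (s i) g)"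
proof (rule LIMSEQ_unique[OF level_sum_tendsto[OF s' g]])
  have "level_sum g B (\<lambda>A. \<Sum>i\<in>I. c i * s i A) = (\<lambda>n. \<Sum>i\<in>I. c i * level_sum g B (s i) n)"
    unfolding level_sum_def Let_def sum_distrib_left
    by (subst sum.swap) (simp add: mult_ac)
  then show "level_sum g B (\<lambda>A. \<Sum>i\<in>I. c i * s i A) \<longlonglongrightarrow> (\<Sum>i\<in>I. c i * signed_integral (s i) g)"
    using s by (simp add: tendsto_sum tendsto_mult level_sum_tendsto[OF _ _ g])
qed

section \<open>Scaling, subadditivity and scalar components of vector measures\<close>

lemma variation_scaled_le:
  assumes "\<And>A. A \<in> sets borel \<Longrightarrow> norm (m A) \<le> c * norm (m' A)" "0 \<le> c"
  shows "variation m E \<le> ennreal c * variation m' E"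
proof (rule variation_least)
  fix A :: "nat \<Rightarrow> 'a set"
  assume A: "\<And>n. A n \<in> sets borel" "disjoint_family A" "(\<Union>n. A n) = E"
  have "(\<Sum>n. ennreal (norm (m (A n)))) \<le> (\<Sum>n. ennreal c * ennreal (norm (m' (A n))))"
    using assms A(1) by (intro suminf_le) (auto simp: ennreal_mult[symmetric] intro: ennreal_leI)
  also have "\<dots> \<le> ennreal c * variation m' E"
    using suminf_le_variation[OF A(1,2), of m'] by (simp add: A(3) mult_left_mono)
  finally show "(\<Sum>n. ennreal (norm (m (A n)))) \<le> ennreal c * variation m' E" .
qed

lemma variation_add_le:
  "variation (\<lambda>A. m A + m' A) E \<le> variation m E + variation m' E"
proof (rule variation_least)
  fix A :: "nat \<Rightarrow> 'a set"
  assume A: "\<And>n. A n \<in> sets borel" "disjoint_family A" "(\<Union>n. A n) = E"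
  have "(\<Sum>n. ennreal (norm (m (A n) + m' (A n)))) \<le> (\<Sum>n. ennreal (norm (m (A n))) + ennreal (norm (m' (A n))))"
    by (intro suminf_le) (auto simp: ennreal_plus[symmetric] norm_triangle_ineq simp del: ennreal_plus intro: ennreal_leI)
  also have "\<dots> = (\<Sum>n. ennreal (norm (m (A n)))) + (\<Sum>n. ennreal (norm (m' (A n))))"
    by (rule suminf_add[symmetric]) auto
  also have "\<dots> \<le> variation m E + variation m' E"
    using suminf_le_variation[OF A(1,2), of m'] suminf_le_variation[OF A(1,2), of m]
    by (simp add: A(3) add_mono)
  finally show "(\<Sum>n. ennreal (norm (m (A n) + m' (A n)))) \<le> variation m E + variation m' E" .
qed

lemma vector_measure_inner:
  assumes "vector_measure D" shows "vector_measure (\<lambda>A. D A \<bullet> x)"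
  unfolding vector_measure_def
proof safe
  show "D {} \<bullet> x = 0" using assms by (simp add: vector_measure_def)
  fix A :: "nat \<Rightarrow> 'a set" assume "range A \<subseteq> sets borel" "disjoint_family A"
  then show "(\<lambda>n. D (A n) \<bullet> x) sums (D (\<Union> (range A)) \<bullet> x)"
    using assms by (intro bounded_linear.sums[OF bounded_linear_inner_left] vector_measure_sums) auto
qed

subsection \<open>Density of test functions\<close>

text \<open>The polynomial is carried along because the family \<open>p(1/t) exp(-1/t)\<close>,
  continued by 0 to the left, is closed under differentiation, which the single function
  \<open>exp(-1/t)\<close> is not.\<close>

definition flat_exp :: "real poly \<Rightarrow> real \<Rightarrow> real" where
  "flat_exp p t = (if 0 < t then poly p (inverse t) * exp (- inverse t) else 0)"

text \<open>The exponent is left arbitrary because splitting off the constant coefficient of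
  \<open>p\<close> raises it by one in the induction.\<close>

lemma tendsto_power_times_poly_div_exp:
  "((\<lambda>u::real. u ^ k * poly p u / exp u) \<longlongrightarrow> 0) at_top"
proof (induction p arbitrary: k)
  case (pCons a p)
  have "((\<lambda>u::real. a * (u ^ k / exp u) + u ^ Suc k * poly p u / exp u) \<longlongrightarrow> a * 0 + 0) at_top"
    by (intro tendsto_add tendsto_mult tendsto_const tendsto_power_div_exp_0 pCons.IH)
  then show ?case by (simp add: field_simps)
qed simp

text \<open>For positive \<open>t\<close> the chain rule gives
  \<open>(p - p')(1/t) exp(-1/t)\<close> times \<open>1/t^2\<close>, and the last factor is what
  \<open>monom 1 2\<close> stands for. The delicate point is 0, where the exponential must beat a
  polynomial in \<open>1/t\<close>.\<close>

lemma flat_exp_deriv: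
  "(flat_exp p has_real_derivative flat_exp (monom 1 2 * (p - pderiv p)) t) (at t)"
proof -
  consider "t < 0" | "t = 0" | "0 < t" by linarith
  then show ?thesis
  proof cases
    case 1
    have "((\<lambda>_. 0) has_real_derivative 0) (at t)" by simp
    then have "(flat_exp p has_real_derivative 0) (at t)"
      by (rule has_field_derivative_transform_within_open[where S = "{..<0}"])
         (use 1 in \<open>auto simp: flat_exp_def\<close>)
    then show ?thesis using 1 by (simp add: flat_exp_def)
  next
    case 2
    \<comment> \<open>With \<open>u = 1/h\<close> the difference quotient at 0 becomes
      \<open>u p(u) / exp u\<close>.\<close>
    have "((\<lambda>h. flat_exp p h / h) \<longlongrightarrow> 0) (at_right 0)"
      unfolding filterlim_at_right_to_top
    proof (rule Lim_transform_eventually)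
      show "((\<lambda>u::real. u ^ 1 * poly p u / exp u) \<longlongrightarrow> 0) at_top"
        by (rule tendsto_power_times_poly_div_exp)
      show "\<forall>\<^sub>F u in at_top. u ^ 1 * poly p u / exp u = flat_exp p (inverse u) / inverse u"
        using eventually_gt_at_top[of 0]
        by eventually_elim (simp add: flat_exp_def exp_minus field_simps)
    qed
    moreover have "((\<lambda>h. flat_exp p h / h) \<longlongrightarrow> 0) (at_left 0)"
    proof (rule Lim_transform_eventually[OF tendsto_const])
      show "\<forall>\<^sub>F h in at_left 0. 0 = flat_exp p h / h"
        unfolding eventually_at_filter by (rule always_eventually) (simp add: flat_exp_def)
    qed
    ultimately have "((\<lambda>h. flat_exp p h / h) \<longlongrightarrow> 0) (at 0)"
      by (simp add: filterlim_split_at)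
    then show ?thesis using 2 by (simp add: DERIV_def flat_exp_def)
  next
    case 3
    have "((\<lambda>t. poly p (inverse t) * exp (- inverse t)) has_real_derivative
        (poly (pderiv p) (inverse t) * (- (inverse t)\<^sup>2)) * exp (- inverse t) +
        (exp (- inverse t) * (inverse t)\<^sup>2) * poly p (inverse t)) (at t)"
      using 3 by (auto intro!: derivative_eq_intros poly_DERIV[THEN DERIV_chain2] simp: power2_eq_square field_simps)
    moreover have "(poly (pderiv p) (inverse t) * (- (inverse t)\<^sup>2)) * exp (- inverse t) +
        (exp (- inverse t) * (inverse t)\<^sup>2) * poly p (inverse t) = flat_exp (monom 1 2 * (p - pderiv p)) t"
      using 3 by (simp add: flat_exp_def poly_monom algebra_simps)
    ultimately have "((\<lambda>t. poly p (inverse t) * exp (- inverse t)) has_real_derivative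
        flat_exp (monom 1 2 * (p - pderiv p)) t) (at t)" by simp
    then show ?thesis
      by (rule has_field_derivative_transform_within_open[where S = "{0<..}"])
         (use 3 in \<open>auto simp: flat_exp_def\<close>)
  qed
qed

text \<open>An algebra of smooth functions, generated so as to be visibly closed under partial
  derivatives, that contains the polynomials and compactly supported bumps.\<close>

inductive smooth_gen :: "('a::euclidean_space \<Rightarrow> real) \<Rightarrow> bool" where
  linear: "bounded_linear f \<Longrightarrow> smooth_gen f"
| const: "smooth_gen (\<lambda>x. c)"
| add: "smooth_gen f \<Longrightarrow> smooth_gen g \<Longrightarrow> smooth_gen (\<lambda>x. f x + g x)"
| mult: "smooth_gen f \<Longrightarrow> smooth_gen g \<Longrightarrow> smooth_gen (\<lambda>x. f x * g x)"
| flat: "smooth_gen (\<lambda>x. flat_exp p (c + x \<bullet> a))"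

text \<open>The derivative in each fixed direction stays in the class; this is the invariant from
  which differentiability of every order follows by induction.\<close>

lemma smooth_gen_has_derivative:
  assumes "smooth_gen f"
  shows "\<exists>f'. (\<forall>x. (f has_derivative f' x) (at x)) \<and> (\<forall>b. smooth_gen (\<lambda>x. f' x b))"
  using assms
proof induction
  case (linear f)
  then show ?case
    by (intro exI[of _ "\<lambda>x. f"]) (auto intro: bounded_linear_imp_has_derivative smooth_gen.const)
next
  case (const c)
  show ?case by (intro exI[of _ "\<lambda>x b. 0"]) (auto intro: smooth_gen.const)
next
  case (add f g)
  then obtain f' g' where "\<forall>x. (f has_derivative f' x) (at x)" "\<forall>b. smooth_gen (\<lambda>x. f' x b)"
    "\<forall>x. (g has_derivative g' x) (at x)" "\<forall>b. smooth_gen (\<lambda>x. g' x b)" by metis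
  then show ?case
    by (intro exI[of _ "\<lambda>x b. f' x b + g' x b"]) (auto intro: has_derivative_add smooth_gen.add)
next
  case (mult f g)
  then obtain f' g' where "\<forall>x. (f has_derivative f' x) (at x)" "\<forall>b. smooth_gen (\<lambda>x. f' x b)"
    "\<forall>x. (g has_derivative g' x) (at x)" "\<forall>b. smooth_gen (\<lambda>x. g' x b)" by metis
  then show ?case using mult.hyps
    by (intro exI[of _ "\<lambda>x b. f x * g' x b + f' x b * g x"] conjI allI has_derivative_mult
         smooth_gen.add smooth_gen.mult) auto
next
  case (flat p c a)
  let ?q = "monom 1 2 * (p - pderiv p)"
  have "((\<lambda>x. flat_exp p (c + x \<bullet> a)) has_derivative (\<lambda>b. flat_exp ?q (c + x \<bullet> a) * (b \<bullet> a))) (at x)" for x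
    by (rule has_derivative_compose[OF _ flat_exp_deriv[unfolded has_field_derivative_def], of "\<lambda>x. c + x \<bullet> a" "\<lambda>b. b \<bullet> a"])
       (auto intro!: derivative_eq_intros)
  then show ?case
    by (intro exI[of _ "\<lambda>x b. flat_exp ?q (c + x \<bullet> a) * (b \<bullet> a)"])
       (blast intro: smooth_gen.mult[OF smooth_gen.flat smooth_gen.const])
qed

lemma smooth_gen_continuous_on: "smooth_gen f \<Longrightarrow> continuous_on A f"
  using smooth_gen_has_derivative[of f]
  by (meson continuous_at_imp_continuous_on has_derivative_continuous)

lemma smooth_gen_times_differentiable: "smooth_gen f \<Longrightarrow> times_differentiable k f"
proof (induction k arbitrary: f)
  case 0
  then show ?case by (simp add: smooth_gen_continuous_on)
next
  case (Suc k)
  obtain f' where f': "\<And>x. (f has_derivative f' x) (at x)" "\<And>b. smooth_gen (\<lambda>x. f' x b)"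
    using smooth_gen_has_derivative[OF Suc.prems] by blast
  have "partial_deriv b f = (\<lambda>x. f' x b)" for b
    unfolding partial_deriv_def using frechet_derivative_at[OF f'(1)] by metis
  then show ?case using f' Suc.IH by (auto simp: differentiable_def)
qed

lemma smooth_gen_prod: "finite I \<Longrightarrow> (\<And>i. i \<in> I \<Longrightarrow> smooth_gen (f i)) \<Longrightarrow> smooth_gen (\<lambda>x. \<Prod>i\<in>I. f i x)"
  by (induction I rule: finite_induct) (auto intro: smooth_gen.intros)

lemma smooth_gen_real_polynomial_function: "real_polynomial_function f \<Longrightarrow> smooth_gen f"
  by (induction rule: real_polynomial_function.induct) (auto intro: smooth_gen.intros)

text \<open>Each coordinate contributes \<open>exp(-1/(r + t)) exp(-1/(r - t))\<close> with
  \<open>t = x \<bullet> b\<close>, so the product is smooth, positive in the open cube of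
  half-width \<open>r\<close> and 0 outside it. A cube fits the generators of
  \<open>smooth_gen\<close>, where \<open>flat_exp\<close> is applied to affine functions.\<close>

definition box_bump :: "real \<Rightarrow> 'a::euclidean_space \<Rightarrow> real" where
  "box_bump r x = (\<Prod>b\<in>Basis. flat_exp 1 (r + x \<bullet> b) * flat_exp 1 (r + x \<bullet> (- b)))"

lemma smooth_gen_box_bump: "smooth_gen (box_bump r)"
  unfolding box_bump_def by (intro smooth_gen_prod smooth_gen.mult smooth_gen.flat) simp

lemma flat_exp_one_bounds: "0 \<le> flat_exp 1 t" "flat_exp 1 t \<le> 1"
  by (auto simp: flat_exp_def)

lemma box_bump_bounds: "0 \<le> box_bump r x" "box_bump r x \<le> 1"
  unfolding box_bump_def
  by (auto intro!: prod_nonneg prod_le_1 mult_le_one mult_nonneg_nonneg simp: flat_exp_one_bounds)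

lemma box_bump_pos: "norm x < r \<Longrightarrow> 0 < box_bump r x"
proof -
  assume x: "norm x < r"
  have "0 < r + x \<bullet> b" "x \<bullet> b < r" if "b \<in> Basis" for b using Basis_le_norm[OF that, of x] x by linarith+
  then show ?thesis unfolding box_bump_def
    by (intro prod_pos mult_pos_pos) (auto simp: flat_exp_def)
qed

lemma box_bump_eq_0:
  assumes "x \<notin> cbox (- r *\<^sub>R One) (r *\<^sub>R One)" shows "box_bump r x = 0"
proof -
  obtain b where "b \<in> Basis" "\<not> (- r \<le> x \<bullet> b \<and> x \<bullet> b \<le> r)"
    using assms by (auto simp: mem_box)
  then show ?thesis unfolding box_bump_def
    by (intro prod_zero bexI[of _ b]) (auto simp: flat_exp_def)
qed

lemma test_function_smooth_gen:
  assumes "smooth_gen f" "compact K" "\<And>x. x \<notin> K \<Longrightarrow> f x = 0"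
  shows "test_function f"
  unfolding test_function_def
proof (intro conjI allI smooth_gen_times_differentiable assms(1))
  have "closure {x. f x \<noteq> 0} \<subseteq> K"
    using assms(2,3) by (intro closure_minimal) (auto intro: compact_imp_closed)
  then show "compact (closure {x. f x \<noteq> 0})"
    using assms(2) by (meson closed_closure closed_subset compact_imp_bounded bounded_subset compact_eq_bounded_closed)
qed

text \<open>The quotient of \<open>g\<close> by a bump is approximated by a polynomial on a cube,
  and the approximant is multiplied by the bump again. As the bump takes values between 0 and 1,
  this does not enlarge the error, and it gives compact support.\<close>

lemma test_function_uniform_approximation:
  fixes g :: "'a::euclidean_space \<Rightarrow> real"
  assumes g: "continuous_on UNIV g" "\<And>x. x \<notin> cball 0 \<rho> \<Longrightarrow> g x = 0" and "0 < \<rho>" "0 < e"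
  shows "\<exists>\<psi>. test_function \<psi> \<and> (\<forall>x. \<bar>\<psi> x - g x\<bar> \<le> e)"
proof -
  define B :: "'a \<Rightarrow> real" where "B = box_bump (\<rho> + 1)"
  let ?Q = "cbox (- (\<rho> + 1) *\<^sub>R One) ((\<rho> + 1) *\<^sub>R One) :: 'a set"
  have contB: "continuous_on A B" for A unfolding B_def by (intro smooth_gen_continuous_on smooth_gen_box_bump)
  obtain z where z: "z \<in> cball 0 \<rho>" "\<And>x. x \<in> cball 0 \<rho> \<Longrightarrow> B z \<le> B x"
    using continuous_attains_inf[OF _ _ contB, of "cball 0 \<rho>"] \<open>0 < \<rho>\<close> by auto
  have Bz: "0 < B z" using z unfolding B_def by (intro box_bump_pos) auto
  \<comment> \<open>\<open>B z\<close> is the positive minimum of the bump on the ball. Taking the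
    maximum with it makes the quotient continuous everywhere and does not alter it where
    \<open>g\<close> can be nonzero.\<close>
  define G where "G x = g x / max (B x) (B z)" for x
  have "continuous_on UNIV G"
    unfolding G_def using Bz by (intro continuous_intros g contB) (auto simp: max_def)
  then have "continuous_on ?Q G" by (rule continuous_on_subset) simp
  then obtain q where q: "real_polynomial_function q" "\<And>x. x \<in> ?Q \<Longrightarrow> \<bar>G x - q x\<bar> < e"
    using Stone_Weierstrass_real_polynomial_function[OF compact_cbox _ \<open>0 < e\<close>] by metis
  have gG: "g x = G x * B x" for x
  proof (cases "x \<in> cball 0 \<rho>")
    case True
    then show ?thesis using z(2)[of x] Bz by (simp add: G_def max_absorb1)
  qed (use g(2) in \<open>simp add: G_def\<close>)
  have "test_function (\<lambda>x. q x * B x)"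
  proof (rule test_function_smooth_gen[where K = ?Q])
    show "smooth_gen (\<lambda>x. q x * B x)" unfolding B_def
      by (rule smooth_gen.mult[OF smooth_gen_real_polynomial_function[OF q(1)] smooth_gen_box_bump])
    show "q x * B x = 0" if "x \<notin> ?Q" for x using box_bump_eq_0[OF that] by (simp add: B_def)
  qed (rule compact_cbox)
  moreover have "\<bar>q x * B x - g x\<bar> \<le> e" for x
  proof (cases "x \<in> ?Q")
    case True
    have "\<bar>q x * B x - g x\<bar> = \<bar>G x - q x\<bar> * B x"
      using box_bump_bounds(1)[of "\<rho> + 1" x]
      unfolding gG left_diff_distrib[symmetric] abs_mult by (simp add: B_def abs_minus_commute)
    also have "\<dots> \<le> e * 1"
      using q(2)[OF True] box_bump_bounds[of "\<rho> + 1" x] \<open>0 < e\<close> unfolding B_def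
      by (intro mult_mono) auto
    finally show ?thesis by simp
  next
    case False
    then have "B x = 0" unfolding B_def by (rule box_bump_eq_0)
    then show ?thesis using gG[of x] \<open>0 < e\<close> by simp
  qed
  ultimately show ?thesis by blast
qed

text \<open>A Urysohn function with values 1 on \<open>K\<close> and -1 on \<open>L\<close> is cut
  off, shrunk by the factor \<open>1 - e / 2\<close> and approximated up to \<open>e / 2\<close>.
  The shrinking makes room for the approximation error, so the result stays between -1 and
  1.\<close>

lemma test_function_separation:
  fixes K L :: "'a::euclidean_space set"
  assumes K: "compact K" "compact L" "K \<inter> L = {}" and e: "0 < e" "e \<le> 1"
  shows "\<exists>\<psi>. test_function \<psi> \<and> (\<forall>x. \<bar>\<psi> x\<bar> \<le> 1) \<and> (\<forall>x\<in>K. 1 - e \<le> \<psi> x) \<and> (\<forall>x\<in>L. \<psi> x \<le> - 1 + e)"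
proof -
  obtain u :: "'a \<Rightarrow> real" where u: "continuous_on UNIV u" "\<And>x. u x \<in> closed_segment 1 (-1)"
      "\<And>x. x \<in> K \<Longrightarrow> u x = 1" "\<And>x. x \<in> L \<Longrightarrow> u x = -1"
    using Urysohn[OF compact_imp_closed[OF K(1)] compact_imp_closed[OF K(2)] K(3)] by metis
  have u1: "\<bar>u x\<bar> \<le> 1" for x using u(2)[of x] by (auto simp: closed_segment_eq_real_ivl abs_le_iff split: if_splits)
  have "bounded (K \<union> L)" using K by (simp add: compact_imp_bounded)
  then obtain \<rho>0 where \<rho>0: "\<forall>x\<in>K \<union> L. norm x \<le> \<rho>0" by (auto simp: bounded_iff)
  define \<rho> where "\<rho> = max 1 \<rho>0"
  have \<rho>: "0 < \<rho>" "\<And>x. x \<in> K \<union> L \<Longrightarrow> norm x \<le> \<rho>"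
    using \<rho>0 by (auto simp: \<rho>_def le_max_iff_disj)
  define v where "v x = max 0 (min 1 (\<rho> + 1 - norm x))" for x :: 'a
  have v: "0 \<le> v x" "v x \<le> 1" for x by (auto simp: v_def)
  have contv: "continuous_on UNIV v" unfolding v_def by (intro continuous_intros)
  define g where "g x = (1 - e / 2) * (u x * v x)" for x
  have "\<bar>u x * v x\<bar> \<le> 1" for x
    using mult_le_one[OF u1[of x] _ v(2)[of x]] v(1)[of x] by (simp add: abs_mult)
  then have g1: "\<bar>g x\<bar> \<le> 1 - e / 2" for x
    using e mult_left_mono[of "\<bar>u x * v x\<bar>" 1 "1 - e/2"] by (simp add: g_def abs_mult)
  have "\<exists>\<psi>. test_function \<psi> \<and> (\<forall>x. \<bar>\<psi> x - g x\<bar> \<le> e / 2)"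
  proof (rule test_function_uniform_approximation)
    show "continuous_on UNIV g" unfolding g_def by (intro continuous_intros u contv)
    show "g x = 0" if "x \<notin> cball 0 (\<rho> + 1)" for x using that by (simp add: g_def v_def)
  qed (use \<rho> e in auto)
  then obtain \<psi> where \<psi>: "test_function \<psi>" "\<And>x. \<bar>\<psi> x - g x\<bar> \<le> e / 2" by blast
  have "g x = 1 - e / 2" if "x \<in> K" for x using that u(3) \<rho>(2)[of x] by (simp add: g_def v_def)
  moreover have "g x = - (1 - e / 2)" if "x \<in> L" for x using that u(4) \<rho>(2)[of x] by (simp add: g_def v_def)
  moreover have "\<bar>\<psi> x\<bar> \<le> 1" for x using \<psi>(2)[of x] g1[of x] by linarith
  ultimately show ?thesis using \<psi> by (smt (verit) field_sum_of_halves)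
qed

subsection \<open>Near-optimal test functions\<close>

lemma test_function_continuous: "test_function \<psi> \<Longrightarrow> continuous_on A \<psi>"
proof -
  assume "test_function \<psi>"
  then have "times_differentiable 0 \<psi>" by (simp only: test_function_def)
  then show ?thesis using continuous_on_subset by auto
qed

lemma test_function_measurable: "test_function \<psi> \<Longrightarrow> \<psi> \<in> borel_measurable borel"
  by (rule borel_measurable_continuous_onI[OF test_function_continuous])

lemma finite_measure_compact_approximation:
  fixes M :: "'a::euclidean_space measure"
  assumes "finite_measure M" and M: "sets M = sets borel" and A: "A \<in> sets borel" and "0 < e"
  obtains K where "compact K" "K \<subseteq> A" "measure M (A - K) \<le> e"
proof -
  interpret finite_measure M by fact
  have "emeasure M A = (SUP K\<in>{K. K \<subseteq> A \<and> compact K}. emeasure M K)"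
    using M A by (intro inner_regular) (auto simp: emeasure_eq_measure)
  moreover have "emeasure M A < emeasure M A + ennreal e"
    using \<open>0 < e\<close> by (simp add: emeasure_eq_measure ennreal_plus[symmetric] ennreal_less_iff del: ennreal_plus)
  ultimately have "emeasure M A < (SUP K\<in>{K. K \<subseteq> A \<and> compact K}. emeasure M K + ennreal e)"
    by (subst ennreal_SUP_add_left) auto
  then obtain K where K: "K \<subseteq> A" "compact K" "emeasure M A < emeasure M K + ennreal e"
    unfolding less_SUP_iff by blast
  then have Km: "K \<in> sets M" using M by (simp add: borel_compact)
  have "measure M A < measure M K + e"
    using K(3) \<open>0 < e\<close> by (simp add: emeasure_eq_measure ennreal_plus[symmetric] ennreal_less_iff del: ennreal_plus)
  moreover have "measure M (A - K) = measure M A - measure M K"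
    using Km A M K(1) by (intro finite_measure_Diff) auto
  ultimately show thesis using K by (intro that[of K]) auto
qed

text \<open>The test function is close to 1 on a compact part of \<open>A\<close> and close to -1 on
  a compact part of \<open>- A\<close>. Only a lower bound for the integral over \<open>P\<close>
  and an upper bound for that over \<open>N\<close> are wanted, so \<open>P\<close> is exhausted
  inside \<open>A\<close> and \<open>N\<close> inside \<open>- A\<close>; elsewhere
  \<open>\<bar>\<psi>\<bar> \<le> 1\<close> already errs in the right direction.\<close>

lemma test_function_integral_near_optimal:
  fixes P N :: "'a::euclidean_space measure"
  assumes P: "finite_measure P" "sets P = sets borel" and N: "finite_measure N" "sets N = sets borel"
    and A: "A \<in> sets borel" and e: "0 < e"
  shows "\<exists>\<psi>. test_function \<psi> \<and> (\<forall>x. \<bar>\<psi> x\<bar> \<le> 1) \<and>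
    (measure P A - measure N A) - (measure P (- A) - measure N (- A)) - e \<le> (\<integral>x. \<psi> x \<partial>P) - (\<integral>x. \<psi> x \<partial>N)"
proof -
  interpret P: finite_measure P by fact
  interpret N: finite_measure N by fact
  have sp: "space P = UNIV" "space N = UNIV" using sets_eq_imp_space_eq[OF P(2)] sets_eq_imp_space_eq[OF N(2)] by simp_all
  \<comment> \<open>Each integral loses \<open>d\<close> times the total mass and twice a remaining
    mass of at most \<open>d\<close>, which adds up to \<open>d\<close> times this
    denominator.\<close>
  define d where "d = min 1 (e / (measure P UNIV + measure N UNIV + 4))"
  have den: "0 < measure P UNIV + measure N UNIV + 4"
    by (intro add_nonneg_pos) auto
  have d: "0 < d" "d \<le> 1" using e den by (auto simp: d_def)
  have "d \<le> e / (measure P UNIV + measure N UNIV + 4)" by (simp add: d_def)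
  then have de: "d * (measure P UNIV + measure N UNIV + 4) \<le> e"
    using den by (simp add: pos_le_divide_eq)
  have A': "- A \<in> sets borel" using A by (simp add: borel_comp)
  obtain K where K: "compact K" "K \<subseteq> A" "measure P (A - K) \<le> d"
    using finite_measure_compact_approximation[OF P A d(1)] .
  obtain L where L: "compact L" "L \<subseteq> - A" "measure N (- A - L) \<le> d"
    using finite_measure_compact_approximation[OF N A' d(1)] .
  have "K \<inter> L = {}" using K(2) L(2) by blast
  then obtain \<psi> where \<psi>: "test_function \<psi>" "\<And>x. \<bar>\<psi> x\<bar> \<le> 1" "\<And>x. x \<in> K \<Longrightarrow> 1 - d \<le> \<psi> x"
      "\<And>x. x \<in> L \<Longrightarrow> \<psi> x \<le> - 1 + d"
    using test_function_separation[OF K(1) L(1) _ d] by blast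
  have [measurable]: "A \<in> sets P" "A \<in> sets N" "- A \<in> sets P" "- A \<in> sets N"
     "A - K \<in> sets P" "- A - L \<in> sets N"
    unfolding P(2) N(2) using A A' borel_compact[OF K(1)] borel_compact[OF L(1)] by (blast intro: sets.Diff)+
  have [measurable]: "\<psi> \<in> borel_measurable P" "\<psi> \<in> borel_measurable N"
    using test_function_measurable[OF \<psi>(1)] P(2) N(2) by (simp_all cong: measurable_cong_sets)
  have int: "integrable P \<psi>" "integrable N \<psi>"
    using \<psi>(2) by (auto intro!: P.integrable_const_bound[of _ 1] N.integrable_const_bound[of _ 1])
  have "(\<integral>x. indicator A x - indicator (- A) x - d - 2 * indicator (A - K) x \<partial>P) \<le> (\<integral>x. \<psi> x \<partial>P)"
  proof (rule integral_mono)
    show "indicator A x - indicator (- A) x - d - 2 * indicator (A - K) x \<le> \<psi> x" for x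
      using \<psi>(2)[of x] \<psi>(3)[of x] d K(2) by (auto simp: indicator_def abs_le_iff)
  qed (auto intro: int simp: P.emeasure_eq_measure)
  moreover have "(\<integral>x. indicator A x - indicator (- A) x - d - 2 * indicator (A - K) x \<partial>P) =
      measure P A - measure P (- A) - d * measure P UNIV - 2 * measure P (A - K)"
    by (simp add: P.emeasure_eq_measure sp)
  moreover have "(\<integral>x. \<psi> x \<partial>N) \<le> (\<integral>x. indicator A x - indicator (- A) x + d + 2 * indicator (- A - L) x \<partial>N)"
  proof (rule integral_mono)
    show "\<psi> x \<le> indicator A x - indicator (- A) x + d + 2 * indicator (- A - L) x" for x
      using \<psi>(2)[of x] \<psi>(4)[of x] d L(2) by (auto simp: indicator_def abs_le_iff)
  qed (auto intro: int simp: N.emeasure_eq_measure)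
  moreover have "(\<integral>x. indicator A x - indicator (- A) x + d + 2 * indicator (- A - L) x \<partial>N) =
      measure N A - measure N (- A) + d * measure N UNIV + 2 * measure N (- A - L)"
    by (simp add: N.emeasure_eq_measure sp)
  moreover have "d * measure P UNIV + d * measure N UNIV + 2 * d + 2 * d \<le> e"
    using de by (simp add: algebra_simps)
  ultimately have "(measure P A - measure N A) - (measure P (- A) - measure N (- A)) - e \<le> (\<integral>x. \<psi> x \<partial>P) - (\<integral>x. \<psi> x \<partial>N)"
    using K(3) L(3) by linarith
  then show ?thesis using \<psi>(1,2) by blast
qed

text \<open>This is \<open>test_function_integral_near_optimal\<close> for the measures with
  densities \<open>max 0 (g x)\<close> and \<open>max 0 (- g x)\<close>, which the set where
  \<open>g\<close> is nonnegative separates.\<close>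

lemma test_function_L1_near_optimal:
  fixes g :: "'a::euclidean_space \<Rightarrow> real"
  assumes g: "integrable lborel g" and e: "0 < e"
  shows "\<exists>\<psi>. test_function \<psi> \<and> (\<forall>x. \<bar>\<psi> x\<bar> \<le> 1) \<and> (\<integral>x. \<bar>g x\<bar> \<partial>lborel) - e \<le> (\<integral>x. g x * \<psi> x \<partial>lborel)"
proof -
  have [measurable]: "g \<in> borel_measurable borel" using g by (simp add: borel_measurable_integrable)
  define P where "P = density lborel (\<lambda>x. ennreal (max 0 (g x)))"
  define N where "N = density lborel (\<lambda>x. ennreal (max 0 (- g x)))"
  let ?A = "{x. 0 \<le> g x}"
  have intP: "integrable lborel (\<lambda>x. max 0 (g x))" "integrable lborel (\<lambda>x. max 0 (- g x))"
    using g by auto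
  have finP: "finite_measure P" and finN: "finite_measure N"
    using nn_integral_eq_integral[OF intP(1)] nn_integral_eq_integral[OF intP(2)]
    unfolding P_def N_def by (auto intro!: finite_measureI simp: emeasure_density)
  have int: "(\<integral>x. h x \<partial>P) = (\<integral>x. max 0 (g x) * h x \<partial>lborel)"
     "(\<integral>x. h x \<partial>N) = (\<integral>x. max 0 (- g x) * h x \<partial>lborel)" if "h \<in> borel_measurable borel" for h :: "'a \<Rightarrow> real"
    using that unfolding P_def N_def by (subst integral_density; simp)+
  have A[measurable]: "?A \<in> sets borel" by measurable
  have sp: "space P = UNIV" "space N = UNIV" by (simp_all add: P_def N_def)
  have ind: "(\<lambda>x. max 0 (g x) * indicator ?A x) = (\<lambda>x. max 0 (g x))"
     "(\<lambda>x. max 0 (g x) * indicator (- ?A) x) = (\<lambda>x. 0)"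
     "(\<lambda>x. max 0 (- g x) * indicator ?A x) = (\<lambda>x. 0)"
     "(\<lambda>x. max 0 (- g x) * indicator (- ?A) x) = (\<lambda>x. max 0 (- g x))"
    by (auto simp: fun_eq_iff indicator_def max_def)
  have "measure P ?A = (\<integral>x. max 0 (g x) \<partial>lborel)" "measure P (- ?A) = 0"
     "measure N ?A = 0" "measure N (- ?A) = (\<integral>x. max 0 (- g x) \<partial>lborel)"
    using int(1)[of "indicator ?A"] int(1)[of "indicator (- ?A)"]
      int(2)[of "indicator ?A"] int(2)[of "indicator (- ?A)"]
    unfolding ind by (simp_all add: sp)
  then have opt: "(measure P ?A - measure N ?A) - (measure P (- ?A) - measure N (- ?A)) = (\<integral>x. \<bar>g x\<bar> \<partial>lborel)"
    using Bochner_Integration.integral_add[OF intP, symmetric]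
    by (auto intro!: Bochner_Integration.integral_cong)
  have "sets P = sets borel" "sets N = sets borel" by (simp_all add: P_def N_def)
  then obtain \<psi> where \<psi>: "test_function \<psi>" "\<forall>x. \<bar>\<psi> x\<bar> \<le> 1"
      "(\<integral>x. \<bar>g x\<bar> \<partial>lborel) - e \<le> (\<integral>x. \<psi> x \<partial>P) - (\<integral>x. \<psi> x \<partial>N)"
    using test_function_integral_near_optimal[OF finP _ finN _ A e] unfolding opt by blast
  note [measurable] = test_function_measurable[OF \<psi>(1)]
  have "\<bar>h x * \<psi> x\<bar> \<le> \<bar>h x\<bar>" for x and h :: "'a \<Rightarrow> real"
    using \<psi>(2) mult_left_le[of "\<bar>\<psi> x\<bar>" "\<bar>h x\<bar>"] by (simp add: abs_mult)
  then have "integrable lborel (\<lambda>x. h x * \<psi> x)" if "integrable lborel h" for h :: "'a \<Rightarrow> real"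
    using that by (intro Bochner_Integration.integrable_bound[OF that]) auto
  then have "(\<integral>x. \<psi> x \<partial>P) - (\<integral>x. \<psi> x \<partial>N) = (\<integral>x. max 0 (g x) * \<psi> x - max 0 (- g x) * \<psi> x \<partial>lborel)"
    using intP by (simp add: int)
  also have "\<dots> = (\<integral>x. g x * \<psi> x \<partial>lborel)"
    by (intro Bochner_Integration.integral_cong) (auto simp: max_def)
  finally show ?thesis using \<psi> by auto
qed

text \<open>An approximate Hahn decomposition: from a near-optimal partition, \<open>A\<close>
  collects the pieces of nonnegative measure.\<close>

lemma variation_near_optimal_set:
  fixes s :: "'a::topological_space set \<Rightarrow> real"
  assumes s: "vector_measure s" "variation s UNIV < \<infinity>" and e: "0 < e"
  obtains A where "A \<in> sets borel" "enn2real (variation s UNIV) - e \<le> s A - s (- A)"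
proof -
  let ?V = "enn2real (variation s UNIV)"
  have V: "variation s UNIV = ennreal ?V" using s(2) by simp
  show thesis
  \<comment> \<open>Since \<open>ennreal\<close> sends negative numbers to 0, approximating the
    supremum strictly requires \<open>?V - e\<close> to be nonnegative. Otherwise the whole space or
    the empty set, according to the sign of \<open>s UNIV\<close>, gives a nonnegative difference,
    and that is enough.\<close>
  proof (cases "?V - e < 0")
    case True
    show thesis
    proof (cases "0 \<le> s UNIV")
      case True
      then show thesis using \<open>?V - e < 0\<close> s(1) by (intro that[of UNIV]) (auto simp: vector_measure_def)
    next
      case False
      then show thesis using \<open>?V - e < 0\<close> s(1) by (intro that[of "{}"]) (auto simp: vector_measure_def)
    qed
  next
    case False
    have "ennreal (?V - e) < variation s UNIV" 
      using e False ennreal_less_iff[of "?V - e" ?V] V by simp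
    then obtain B :: "nat \<Rightarrow> 'a set" where B: "range B \<subseteq> sets borel" "disjoint_family B" "(\<Union>n. B n) = UNIV"
        "ennreal (?V - e) < (\<Sum>n. ennreal (norm (s (B n))))"
      unfolding variation_def less_SUP_iff by auto
    define A where "A = (\<Union>n\<in>{n. 0 \<le> s (B n)}. B n)"
    have A: "A \<in> sets borel" using B(1) by (auto simp: A_def)
    have inA: "B n \<inter> A = (if 0 \<le> s (B n) then B n else {})"
       "B n \<inter> - A = (if 0 \<le> s (B n) then {} else B n)" for n
    proof -
      have "m = n" if "x \<in> B m" "x \<in> B n" for x m
        using B(2) that unfolding disjoint_family_on_def by blast
      then show "B n \<inter> A = (if 0 \<le> s (B n) then B n else {})"
         "B n \<inter> - A = (if 0 \<le> s (B n) then {} else B n)"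
        unfolding A_def by auto
    qed
    have s0: "s {} = 0" using s(1) by (simp add: vector_measure_def)
    have sumsX: "(\<lambda>n. s (B n \<inter> X)) sums s X" if "X \<in> sets borel" for X
    proof -
      have "(\<lambda>n. s (B n \<inter> X)) sums s (\<Union>n. B n \<inter> X)"
        using B(1,2) that by (intro vector_measure_sums s) (auto simp: disjoint_family_on_def)
      moreover have "(\<Union>n. B n \<inter> X) = X" using B(3) by blast
      ultimately show ?thesis by simp
    qed
    have "(\<lambda>n. s (B n \<inter> A) - s (B n \<inter> - A)) sums (s A - s (- A))"
      using A by (intro sums_diff sumsX) (auto simp: borel_comp)
    moreover have "s (B n \<inter> A) - s (B n \<inter> - A) = norm (s (B n))" for n
      by (simp add: inA s0)
    ultimately have "(\<lambda>n. norm (s (B n))) sums (s A - s (- A))" by simp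
    then have "(\<Sum>n. ennreal (norm (s (B n)))) = ennreal (s A - s (- A))"
      by (intro suminf_ennreal_eq) auto
    then have "?V - e \<le> s A - s (- A)" using B(4) False by (auto simp: ennreal_less_iff)
    then show thesis using that A by blast
  qed
qed

text \<open>Together with \<open>signed_integral_bound\<close> this makes the total variation the
  supremum of signed integrals of test functions bounded by 1.\<close>

lemma test_function_signed_near_optimal:
  fixes s :: "'a::euclidean_space set \<Rightarrow> real"
  assumes s: "vector_measure s" "variation s UNIV < \<infinity>" and e: "0 < e"
  shows "\<exists>\<psi>. test_function \<psi> \<and> (\<forall>x. \<bar>\<psi> x\<bar> \<le> 1) \<and> enn2real (variation s UNIV) - e \<le> signed_integral s \<psi>"
proof -
  obtain A where A: "A \<in> sets borel" "enn2real (variation s UNIV) - e / 2 \<le> s A - s (- A)"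
    using variation_near_optimal_set[OF s, of "e / 2"] e by auto
  have A': "- A \<in> sets borel" using A(1) by (simp add: borel_comp)
  obtain \<psi> where "test_function \<psi>" "\<forall>x. \<bar>\<psi> x\<bar> \<le> 1"
    "measure (jordan_pos s) A - measure (jordan_neg s) A -
      (measure (jordan_pos s) (- A) - measure (jordan_neg s) (- A)) - e / 2 \<le> signed_integral s \<psi>"
    using test_function_integral_near_optimal[OF finite_measure_jordan(1)[OF s] sets_jordan(1)[OF s]
      finite_measure_jordan(2)[OF s] sets_jordan(2)[OF s] A(1), of "e / 2"] e
    unfolding signed_integral_def by auto
  moreover have "measure (jordan_pos s) B - measure (jordan_neg s) B = s B" if "B \<in> sets borel" for B
    using measure_jordan[OF s that] by (simp add: field_simps)
  ultimately show ?thesis using A A' by fastforce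
qed

subsection \<open>Translates of functions of bounded variation\<close>

lemma lborel_integrable_shift:
  fixes f :: "'a::euclidean_space \<Rightarrow> real"
  assumes "integrable lborel f"
  shows "integrable lborel (\<lambda>y. f (x + y))"
proof -
  have "integrable (distr lborel borel ((+) x)) f" using assms by (simp add: lborel_distr_plus)
  then show ?thesis using assms by (subst (asm) integrable_distr_eq) auto
qed

lemma lborel_integral_shift:
  fixes f :: "'a::euclidean_space \<Rightarrow> real"
  assumes "f \<in> borel_measurable borel"
  shows "(\<integral>y. f (x + y) \<partial>lborel) = (\<integral>y. f y \<partial>lborel)"
proof -
  have "(\<integral>y. f y \<partial>lborel) = (\<integral>y. f y \<partial>distr lborel borel ((+) x))" by (simp add: lborel_distr_plus)
  also have "\<dots> = (\<integral>y. f (x + y) \<partial>lborel)" using assms by (intro integral_distr) auto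
  finally show ?thesis ..
qed

section \<open>Derivatives, bounds and translates of test functions\<close>

lemma test_function_differentiable:
  assumes "test_function \<psi>" shows "\<psi> differentiable (at x)"
proof -
  have "times_differentiable (Suc 0) \<psi>" using assms by (simp only: test_function_def)
  then show ?thesis by simp
qed

lemma test_function_has_derivative:
  assumes "test_function \<psi>" shows "(\<psi> has_derivative frechet_derivative \<psi> (at x)) (at x)"
  using test_function_differentiable[OF assms] frechet_derivative_works by blast

lemma test_function_shift:
  assumes "test_function \<psi>" shows "test_function (\<lambda>y. \<psi> (y - a))"
  unfolding test_function_def
proof (intro conjI allI)
  have "times_differentiable k (\<lambda>y. g (y - a))" if "times_differentiable k g" for k and g :: "'a \<Rightarrow> real"
    using that
  proof (induction k arbitrary: g)
    case 0
    have "continuous_on UNIV (g \<circ> (\<lambda>y. y - a))"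
      using 0 by (intro continuous_on_compose continuous_intros) (auto intro: continuous_on_subset)
    then show ?case by (simp add: comp_def)
  next
    case (Suc k)
    have d: "((\<lambda>y. g (y - a)) has_derivative frechet_derivative g (at (x - a))) (at x)" for x
    proof -
      have "(g has_derivative frechet_derivative g (at (x - a))) (at (x - a))"
        using Suc.prems frechet_derivative_works by auto
      moreover have "((\<lambda>y. y - a) has_derivative (\<lambda>h. h)) (at x)"
        by (auto intro!: derivative_eq_intros)
      ultimately show ?thesis
        using has_derivative_compose[of "\<lambda>y. y - a" "\<lambda>h. h" x UNIV g] by blast
    qed
    then have "partial_deriv b (\<lambda>y. g (y - a)) = (\<lambda>y. partial_deriv b g (y - a))" for b
      unfolding partial_deriv_def using frechet_derivative_at[OF d] by metis
    then show ?case using Suc d by (auto simp: differentiable_def)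
  qed
  then show "times_differentiable k (\<lambda>y. \<psi> (y - a))" for k
    using assms by (simp add: test_function_def)
  have "{y. \<psi> (y - a) \<noteq> 0} = (+) a ` {y. \<psi> y \<noteq> 0}"
    by (auto simp: image_iff intro!: exI[of _ "_ - a"])
  then show "compact (closure {y. \<psi> (y - a) \<noteq> 0})"
    using assms compact_translation[of "closure {y. \<psi> y \<noteq> 0}" a]
    by (simp add: test_function_def closure_translation)
qed

lemma frechet_derivative_eq_sum_partial_deriv:
  fixes \<psi> :: "'a::euclidean_space \<Rightarrow> real"
  assumes "test_function \<psi>"
  shows "frechet_derivative \<psi> (at y) x = (\<Sum>b\<in>Basis. (x \<bullet> b) * partial_deriv b \<psi> y)"
proof -
  interpret linear "frechet_derivative \<psi> (at y)"
    using test_function_has_derivative[OF assms] has_derivative_linear by blast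
  have "frechet_derivative \<psi> (at y) x = frechet_derivative \<psi> (at y) (\<Sum>b\<in>Basis. (x \<bullet> b) *\<^sub>R b)"
    by (simp add: euclidean_representation)
  then show ?thesis by (simp add: sum scale partial_deriv_def)
qed

lemma test_function_partial_deriv_continuous:
  assumes "test_function \<psi>" "b \<in> Basis" shows "continuous_on A (partial_deriv b \<psi>)"
proof -
  have "times_differentiable (Suc 0) \<psi>" using assms by (simp only: test_function_def)
  then show ?thesis using assms(2) continuous_on_subset by fastforce
qed

text \<open>Continuity gives a bound on the compact support; off the support \<open>\<psi>\<close>
  vanishes on an open set, and its derivative with it.\<close>

lemma test_function_partial_deriv_bounded:
  assumes \<psi>: "test_function \<psi>" and b: "b \<in> Basis"
  shows "\<exists>L. \<forall>x. \<bar>partial_deriv b \<psi> x\<bar> \<le> L"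
proof -
  let ?S = "closure {x. \<psi> x \<noteq> 0}"
  have "compact (partial_deriv b \<psi> ` ?S)"
    using \<psi> b by (intro compact_continuous_image test_function_partial_deriv_continuous) (auto simp: test_function_def)
  then obtain L where L: "\<And>x. x \<in> ?S \<Longrightarrow> \<bar>partial_deriv b \<psi> x\<bar> \<le> L"
    using compact_imp_bounded bounded_iff by (metis imageI real_norm_def)
  have "partial_deriv b \<psi> x = 0" if "x \<notin> ?S" for x
  proof -
    have "((\<lambda>_. 0) has_derivative (\<lambda>_. 0)) (at x)" by simp
    then have "(\<psi> has_derivative (\<lambda>_. 0)) (at x)"
    proof (rule has_derivative_transform_within_open)
      show "open (- ?S)" "x \<in> - ?S" using that by auto
      show "0 = \<psi> y" if "y \<in> - ?S" for y using that closure_subset[of "{x. \<psi> x \<noteq> 0}"] by auto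
    qed
    then show ?thesis unfolding partial_deriv_def using frechet_derivative_at by metis
  qed
  then have "\<bar>partial_deriv b \<psi> x\<bar> \<le> max 0 L" for x using L[of x] by (cases "x \<in> ?S") auto
  then show ?thesis by blast
qed

lemma test_function_bounded_derivative:
  fixes \<psi> :: "'a::euclidean_space \<Rightarrow> real"
  assumes \<psi>: "test_function \<psi>"
  obtains L where "0 \<le> L" "\<And>y. \<bar>frechet_derivative \<psi> (at y) x\<bar> \<le> L"
proof -
  obtain L where L: "\<And>b y. b \<in> Basis \<Longrightarrow> \<bar>partial_deriv b \<psi> y\<bar> \<le> L b"
    using test_function_partial_deriv_bounded[OF \<psi>] by metis
  have *: "\<bar>frechet_derivative \<psi> (at y) x\<bar> \<le> (\<Sum>b\<in>Basis. \<bar>x \<bullet> b\<bar> * L b)" for y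
    unfolding frechet_derivative_eq_sum_partial_deriv[OF \<psi>]
    by (rule order_trans[OF sum_abs]) (auto simp: abs_mult intro!: sum_mono mult_left_mono L)
  then have "0 \<le> (\<Sum>b\<in>Basis. \<bar>x \<bullet> b\<bar> * L b)" by (meson abs_ge_zero order_trans)
  with * show thesis using that by blast
qed

lemma test_function_bounded: 
  fixes \<psi> :: "'a::euclidean_space \<Rightarrow> real"
  assumes \<psi>: "test_function \<psi>"
  obtains L where "\<And>y. \<bar>\<psi> y\<bar> \<le> L"
proof -
  let ?S = "closure {x. \<psi> x \<noteq> 0}"
  have "compact (\<psi> ` ?S)"
    using \<psi> by (intro compact_continuous_image test_function_continuous) (auto simp: test_function_def)
  then obtain L where L: "\<And>x. x \<in> ?S \<Longrightarrow> \<bar>\<psi> x\<bar> \<le> L"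
    using compact_imp_bounded bounded_iff by (metis imageI real_norm_def)
  have "\<bar>\<psi> x\<bar> \<le> max 0 L" for x
  proof (cases "x \<in> ?S")
    case True
    then show ?thesis using L by fastforce
  next
    case False
    then have "x \<notin> {x. \<psi> x \<noteq> 0}" by (rule contra_subsetD[OF closure_subset])
    then show ?thesis by simp
  qed
  then show thesis using that by blast
qed

lemma test_function_directional_measurable:
  assumes "test_function \<psi>" shows "(\<lambda>y. frechet_derivative \<psi> (at y) x) \<in> borel_measurable borel"
proof -
  have "(\<lambda>y. frechet_derivative \<psi> (at y) x) = (\<lambda>y. \<Sum>b\<in>Basis. (x \<bullet> b) * partial_deriv b \<psi> y)"
    using frechet_derivative_eq_sum_partial_deriv[OF assms] by blast
  moreover have "continuous_on UNIV \<dots>"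
    by (intro continuous_intros test_function_partial_deriv_continuous[OF assms])
  ultimately show ?thesis by (simp add: borel_measurable_continuous_onI)
qed

lemma integrable_mult_bounded:
  fixes f g :: "'a::euclidean_space \<Rightarrow> real"
  assumes f: "integrable lborel f" and g: "g \<in> borel_measurable borel" "\<And>x. \<bar>g x\<bar> \<le> L"
  shows "integrable lborel (\<lambda>x. f x * g x)"
proof (rule Bochner_Integration.integrable_bound)
  show "integrable lborel (\<lambda>x. L * f x)" using f by simp
  show "(\<lambda>x. f x * g x) \<in> borel_measurable lborel"
    using borel_measurable_integrable[OF f] g(1) by simp
  have "\<bar>f x * g x\<bar> \<le> \<bar>L * f x\<bar>" for x
    using mult_right_mono[OF g(2)[of x], of "\<bar>f x\<bar>"] g(2)[of x] by (simp add: abs_mult mult.commute)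
  then show "AE x in lborel. norm (f x * g x) \<le> norm (L * f x)" by simp
qed

text \<open>The parameter enters through \<open>\<psi>\<close> alone, so integrability of
  \<open>f\<close> is enough: the difference quotients are dominated by
  \<open>L * \<bar>f y\<bar>\<close>, and dominated convergence applies along every sequence tending
  to \<open>t\<close>.\<close>

lemma shifted_integral_has_derivative:
  fixes f :: "'a::euclidean_space \<Rightarrow> real"
  assumes f: "integrable lborel f" and \<psi>: "test_function \<psi>"
  shows "((\<lambda>t. \<integral>y. f y * \<psi> (y - t *\<^sub>R x) \<partial>lborel) has_real_derivative
    - (\<integral>y. f y * frechet_derivative \<psi> (at (y - t *\<^sub>R x)) x \<partial>lborel)) (at t)"
proof -
  note [measurable] = borel_measurable_integrable[OF f] test_function_measurable[OF \<psi>]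
    test_function_directional_measurable[OF \<psi>]
  let ?d = "\<lambda>y. frechet_derivative \<psi> (at y) x"
  obtain L where L: "0 \<le> L" "\<And>y. \<bar>?d y\<bar> \<le> L" using test_function_bounded_derivative[OF \<psi>, where x = x] by blast
  obtain B where B: "\<And>y. \<bar>\<psi> y\<bar> \<le> B" using test_function_bounded[OF \<psi>] by blast
  have deriv: "((\<lambda>t. \<psi> (y - t *\<^sub>R x)) has_real_derivative - ?d (y - t *\<^sub>R x)) (at t)" for y t
  proof -
    have lin: "linear (frechet_derivative \<psi> (at (y - t *\<^sub>R x)))"
      using test_function_has_derivative[OF \<psi>] has_derivative_linear by blast
    have "((\<lambda>t. \<psi> (y - t *\<^sub>R x)) has_derivative (\<lambda>h. frechet_derivative \<psi> (at (y - t *\<^sub>R x)) (- (h *\<^sub>R x)))) (at t)"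
      by (rule has_derivative_compose[OF _ test_function_has_derivative[OF \<psi>], of "\<lambda>t. y - t *\<^sub>R x" "\<lambda>h. - (h *\<^sub>R x)"])
         (auto intro!: derivative_eq_intros)
    moreover have "(\<lambda>h. frechet_derivative \<psi> (at (y - t *\<^sub>R x)) (- (h *\<^sub>R x))) = (*) (- ?d (y - t *\<^sub>R x))"
      by (simp add: fun_eq_iff linear_neg[OF lin] linear_scale[OF lin])
    ultimately show ?thesis unfolding has_field_derivative_def by simp
  qed
  have lip: "\<bar>\<psi> (y - u *\<^sub>R x) - \<psi> (y - t *\<^sub>R x)\<bar> \<le> L * \<bar>u - t\<bar>" for y u t
    using field_differentiable_bound[of UNIV "\<lambda>t. \<psi> (y - t *\<^sub>R x)" "\<lambda>t. - ?d (y - t *\<^sub>R x)" L u t] deriv L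
    by simp
  have [simp]: "integrable lborel (\<lambda>y. f y * \<psi> (y - u *\<^sub>R x))" for u
    by (rule integrable_mult_bounded[OF f _ B]) measurable
  show ?thesis
    unfolding has_field_derivative_iff tendsto_at_iff_sequentially comp_def
  proof (intro allI impI)
    fix u :: "nat \<Rightarrow> real" assume u: "\<forall>i. u i \<in> UNIV - {t}" "u \<longlonglongrightarrow> t"
    have "(\<lambda>i. \<integral>y. f y * ((\<psi> (y - u i *\<^sub>R x) - \<psi> (y - t *\<^sub>R x)) / (u i - t)) \<partial>lborel) \<longlonglongrightarrow>
       (\<integral>y. f y * - ?d (y - t *\<^sub>R x) \<partial>lborel)"
    proof (rule integral_dominated_convergence[where w = "\<lambda>y. L * \<bar>f y\<bar>"])
      show "AE y in lborel. (\<lambda>i. f y * ((\<psi> (y - u i *\<^sub>R x) - \<psi> (y - t *\<^sub>R x)) / (u i - t))) \<longlonglongrightarrow>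
          f y * - ?d (y - t *\<^sub>R x)"
        using deriv[of _ t] u unfolding has_field_derivative_iff tendsto_at_iff_sequentially comp_def
        by (intro AE_I2 tendsto_mult tendsto_const) blast
      show "AE y in lborel. norm (f y * ((\<psi> (y - u i *\<^sub>R x) - \<psi> (y - t *\<^sub>R x)) / (u i - t))) \<le> L * \<bar>f y\<bar>" for i
      proof (rule AE_I2)
        fix y
        have "\<bar>u i - t\<bar> > 0" using u(1) by auto
        then have "\<bar>(\<psi> (y - u i *\<^sub>R x) - \<psi> (y - t *\<^sub>R x)) / (u i - t)\<bar> \<le> L"
          using lip[of y "u i" t] by (simp add: abs_divide pos_divide_le_eq)
        then show "norm (f y * ((\<psi> (y - u i *\<^sub>R x) - \<psi> (y - t *\<^sub>R x)) / (u i - t))) \<le> L * \<bar>f y\<bar>"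
          by (metis abs_ge_zero abs_mult mult.commute mult_right_mono real_norm_def)
      qed
    qed (use f in auto)
    moreover have "(\<integral>y. f y * (\<psi> (y - u i *\<^sub>R x) - \<psi> (y - t *\<^sub>R x)) \<partial>lborel) =
      (\<integral>y. f y * \<psi> (y - u i *\<^sub>R x) \<partial>lborel) - (\<integral>y. f y * \<psi> (y - t *\<^sub>R x) \<partial>lborel)" for i
      by (simp add: right_diff_distrib)
    ultimately show "(\<lambda>i. ((\<integral>y. f y * \<psi> (y - u i *\<^sub>R x) \<partial>lborel) - (\<integral>y. f y * \<psi> (y - t *\<^sub>R x) \<partial>lborel)) / (u i - t))
       \<longlonglongrightarrow> - (\<integral>y. f y * ?d (y - t *\<^sub>R x) \<partial>lborel)"
      by simp
  qed
qed

lemma variation_inner_le: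
  "variation (\<lambda>A. D A \<bullet> x) E \<le> ennreal (norm x) * variation D E"
proof (rule variation_scaled_le)
  show "norm (D A \<bullet> x) \<le> norm x * norm (D A)" for A
    using Cauchy_Schwarz_ineq2[of "D A" x] by (simp add: mult.commute)
qed simp

text \<open>Real-valued, for use in Bochner integrals and difference quotients. For a gradient
  measure the variation is finite, so \<open>enn2real\<close> loses nothing.\<close>

definition directional_variation :: "('a::euclidean_space set \<Rightarrow> 'a) \<Rightarrow> 'a \<Rightarrow> real" where
  "directional_variation D x = enn2real (variation (\<lambda>A. D A \<bullet> x) UNIV)"

definition shift_distance :: "('a::euclidean_space \<Rightarrow> real) \<Rightarrow> 'a \<Rightarrow> real" where
  "shift_distance f x = (\<integral>y. \<bar>f (x + y) - f y\<bar> \<partial>lborel)"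

lemma directional_variation_nonneg: "0 \<le> directional_variation D x"
  by (simp add: directional_variation_def)

lemma shift_distance_nonneg: "0 \<le> shift_distance f x"
  by (simp add: shift_distance_def)

context
  fixes f :: "'a::euclidean_space \<Rightarrow> real" and D :: "'a set \<Rightarrow> 'a"
  assumes f: "integrable lborel f" and D: "gradient_measure f D"
begin

lemma directional_vector_measure: "vector_measure (\<lambda>A. D A \<bullet> x)"
  using D by (auto simp: gradient_measure_def intro: vector_measure_inner)

lemma directional_finite: "variation (\<lambda>A. D A \<bullet> x) UNIV < \<infinity>"
proof -
  have "variation D UNIV < \<infinity>" using D by (simp add: gradient_measure_def)
  then show ?thesis
    by (intro le_less_trans[OF variation_inner_le]) (simp add: ennreal_mult_less_top)
qed

lemma variation_eq_directional_variation:
  "variation (\<lambda>A. D A \<bullet> x) UNIV = ennreal (directional_variation D x)"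
  unfolding directional_variation_def using directional_finite[of x] by simp

text \<open>\<open>gradient_measure\<close> speaks of basis directions only. Expanding
  \<open>x\<close> in the basis leaves a combination of signed integrals, which
  \<open>signed_integral_linear_combination\<close> turns into one.\<close>

lemma directional_integration_by_parts:
  assumes \<phi>: "test_function \<phi>"
  shows "(\<integral>y. f y * frechet_derivative \<phi> (at y) x \<partial>lborel) = - signed_integral (\<lambda>A. D A \<bullet> x) \<phi>"
proof -
  obtain L where L: "\<And>b y. b \<in> Basis \<Longrightarrow> \<bar>partial_deriv b \<phi> y\<bar> \<le> L b"
    using test_function_partial_deriv_bounded[OF \<phi>] by metis
  obtain B where B: "\<And>y. \<bar>\<phi> y\<bar> \<le> B" using test_function_bounded[OF \<phi>] by blast
  have int: "integrable lborel (\<lambda>y. f y * partial_deriv b \<phi> y)" if "b \<in> Basis" for b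
    using that by (intro integrable_mult_bounded[OF f _ L])
      (auto intro!: borel_measurable_continuous_onI test_function_partial_deriv_continuous[OF \<phi>])
  have "(\<integral>y. f y * frechet_derivative \<phi> (at y) x \<partial>lborel) =
      (\<integral>y. (\<Sum>b\<in>Basis. (x \<bullet> b) * (f y * partial_deriv b \<phi> y)) \<partial>lborel)"
    by (simp add: frechet_derivative_eq_sum_partial_deriv[OF \<phi>] sum_distrib_left mult_ac)
  also have "\<dots> = (\<Sum>b\<in>Basis. (x \<bullet> b) * (\<integral>y. f y * partial_deriv b \<phi> y \<partial>lborel))"
    using int by (subst Bochner_Integration.integral_sum) auto
  also have "\<dots> = - (\<Sum>b\<in>Basis. (x \<bullet> b) * signed_integral (\<lambda>A. D A \<bullet> b) \<phi>)"
    using D \<phi> by (simp add: gradient_measure_def sum_negf)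
  also have "(\<Sum>b\<in>Basis. (x \<bullet> b) * signed_integral (\<lambda>A. D A \<bullet> b) \<phi>) =
      signed_integral (\<lambda>A. \<Sum>b\<in>Basis. (x \<bullet> b) * (D A \<bullet> b)) \<phi>"
  proof (rule signed_integral_linear_combination[symmetric])
    have eq: "(\<lambda>A. \<Sum>b\<in>Basis. (x \<bullet> b) * (D A \<bullet> b)) = (\<lambda>A. D A \<bullet> x)"
      by (simp add: euclidean_inner[of _ x] mult.commute)
    show "vector_measure (\<lambda>A. \<Sum>b\<in>Basis. (x \<bullet> b) * (D A \<bullet> b))"
      "variation (\<lambda>A. \<Sum>b\<in>Basis. (x \<bullet> b) * (D A \<bullet> b)) UNIV < \<infinity>"
      unfolding eq by (rule directional_vector_measure directional_finite)+
  qed (use B test_function_measurable[OF \<phi>] directional_vector_measure directional_finite in auto)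
  also have "(\<lambda>A. \<Sum>b\<in>Basis. (x \<bullet> b) * (D A \<bullet> b)) = (\<lambda>A. D A \<bullet> x)"
    by (simp add: euclidean_inner[of _ x] mult.commute)
  finally show ?thesis .
qed

text \<open>The minus sign from differentiating the translation and the one from integration by
  parts cancel.\<close>

lemma shifted_integral_deriv:
  assumes \<psi>: "test_function \<psi>"
  shows "((\<lambda>t. \<integral>y. f y * \<psi> (y - t *\<^sub>R x) \<partial>lborel) has_real_derivative
    signed_integral (\<lambda>A. D A \<bullet> x) (\<lambda>y. \<psi> (y - t *\<^sub>R x))) (at t)"
proof -
  have "frechet_derivative (\<lambda>y. \<psi> (y - t *\<^sub>R x)) (at y) = frechet_derivative \<psi> (at (y - t *\<^sub>R x))" for y
  proof -
    have "((\<lambda>y. y - t *\<^sub>R x) has_derivative (\<lambda>h. h)) (at y)"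
      by (auto intro!: derivative_eq_intros)
    then have "((\<lambda>y. \<psi> (y - t *\<^sub>R x)) has_derivative frechet_derivative \<psi> (at (y - t *\<^sub>R x))) (at y)"
      using has_derivative_compose test_function_has_derivative[OF \<psi>] by blast
    then show ?thesis using frechet_derivative_at by metis
  qed
  then show ?thesis
    using shifted_integral_has_derivative[OF f \<psi>, of x t]
      directional_integration_by_parts[OF test_function_shift[OF \<psi>], of "t *\<^sub>R x" x] by simp
qed

lemma shifted_integral_diff:
  assumes \<psi>: "test_function \<psi>"
  shows "(\<integral>y. f y * \<psi> (y - x) \<partial>lborel) - (\<integral>y. f y * \<psi> y \<partial>lborel) = (\<integral>y. (f (x + y) - f y) * \<psi> y \<partial>lborel)"
proof -
  note [measurable] = borel_measurable_integrable[OF f] test_function_measurable[OF \<psi>]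
  obtain B where B: "\<And>y. \<bar>\<psi> y\<bar> \<le> B" using test_function_bounded[OF \<psi>] by blast
  have "(\<integral>y. f y * \<psi> (y - x) \<partial>lborel) = (\<integral>y. f (x + y) * \<psi> y \<partial>lborel)"
    using lborel_integral_shift[of "\<lambda>y. f y * \<psi> (y - x)" x] by simp
  moreover have "integrable lborel (\<lambda>y. f (x + y) * \<psi> y)" "integrable lborel (\<lambda>y. f y * \<psi> y)"
    by (auto intro!: integrable_mult_bounded[OF _ _ B] lborel_integrable_shift f)
  ultimately show ?thesis by (simp add: left_diff_distrib)
qed

lemma integrable_shift_diff: "integrable lborel (\<lambda>y. f (x + y) - f y)"
  using lborel_integrable_shift[OF f] f by simp

lemma shift_distance_le_directional_variation: "shift_distance f x \<le> directional_variation D x"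
proof (rule field_le_epsilon)
  fix e :: real assume "0 < e"
  then obtain \<psi> where \<psi>: "test_function \<psi>" "\<And>x. \<bar>\<psi> x\<bar> \<le> 1"
     "shift_distance f x - e \<le> (\<integral>y. (f (x + y) - f y) * \<psi> y \<partial>lborel)"
    using test_function_L1_near_optimal[OF integrable_shift_diff] unfolding shift_distance_def by metis
  let ?F = "\<lambda>t. \<integral>y. f y * \<psi> (y - t *\<^sub>R x) \<partial>lborel"
  \<comment> \<open>Translates of \<open>\<psi>\<close> are bounded by 1 as well, so the derivative
    is controlled for every \<open>t\<close> and not only at 0.\<close>
  have "\<bar>signed_integral (\<lambda>A. D A \<bullet> x) (\<lambda>y. \<psi> (y - t *\<^sub>R x))\<bar> \<le> directional_variation D x" for t
    using signed_integral_bound[OF directional_vector_measure directional_finite, of "\<lambda>y. \<psi> (y - t *\<^sub>R x)" 1] \<psi>(2)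
    by (simp add: directional_variation_def)
  then have "norm (?F 1 - ?F 0) \<le> directional_variation D x * norm (1 - 0 :: real)"
    by (intro field_differentiable_bound[of UNIV ?F "\<lambda>t. signed_integral (\<lambda>A. D A \<bullet> x) (\<lambda>y. \<psi> (y - t *\<^sub>R x))"])
       (auto intro: shifted_integral_deriv[OF \<psi>(1)])
  then show "shift_distance f x \<le> directional_variation D x + e"
    using \<psi>(3) shifted_integral_diff[OF \<psi>(1), of x] by simp
qed

text \<open>One half of \<open>e\<close> pays for the choice of \<open>\<psi>\<close>, the other for
  replacing the derivative at 0 by a difference quotient. The threshold depends on \<open>x\<close>
  through \<open>\<psi>\<close>; \<open>shift_distance_uniform_lower\<close> removes this
  dependence.\<close>

lemma shift_distance_lower:
  assumes e: "0 < e"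
  shows "\<exists>\<delta>>0. \<forall>t. 0 < t \<and> t < \<delta> \<longrightarrow> t * (directional_variation D x - e) \<le> shift_distance f (t *\<^sub>R x)"
proof -
  obtain \<psi> where \<psi>: "test_function \<psi>" "\<And>x. \<bar>\<psi> x\<bar> \<le> 1"
     "directional_variation D x - e / 2 \<le> signed_integral (\<lambda>A. D A \<bullet> x) \<psi>"
    using test_function_signed_near_optimal[OF directional_vector_measure directional_finite, of "e / 2"] e
    unfolding directional_variation_def by (metis half_gt_zero)
  let ?F = "\<lambda>t. \<integral>y. f y * \<psi> (y - t *\<^sub>R x) \<partial>lborel"
  let ?s = "signed_integral (\<lambda>A. D A \<bullet> x) \<psi>"
  have "(?F has_real_derivative ?s) (at 0)"
    using shifted_integral_deriv[OF \<psi>(1), of x 0] by simp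
  then have lim: "((\<lambda>t. (?F t - ?F 0) / (t - 0)) \<longlongrightarrow> ?s) (at 0)"
    unfolding has_field_derivative_iff .
  then obtain \<delta> where \<delta>: "0 < \<delta>" "\<forall>t. t \<noteq> 0 \<and> \<bar>t\<bar> < \<delta> \<longrightarrow> \<bar>(?F t - ?F 0) / t - ?s\<bar> < e / 2"
    using LIM_D[OF lim, of "e / 2"] e by auto
  have "t * (directional_variation D x - e) \<le> shift_distance f (t *\<^sub>R x)" if t: "0 < t" "t < \<delta>" for t
  proof -
    have "directional_variation D x - e \<le> (?F t - ?F 0) / t"
    proof -
      have "\<bar>(?F t - ?F 0) / t - ?s\<bar> < e / 2" using \<delta>(2) t by auto
      then show ?thesis using \<psi>(3) by linarith
    qed
    then have "t * (directional_variation D x - e) \<le> ?F t - ?F 0"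
      using t by (simp add: field_simps)
    also have "\<dots> = (\<integral>y. (f (t *\<^sub>R x + y) - f y) * \<psi> y \<partial>lborel)"
      using shifted_integral_diff[OF \<psi>(1), of "t *\<^sub>R x"] by simp
    also have "\<dots> \<le> shift_distance f (t *\<^sub>R x)"
      unfolding shift_distance_def
    proof (rule integral_mono)
      show "integrable lborel (\<lambda>y. (f (t *\<^sub>R x + y) - f y) * \<psi> y)"
        by (rule integrable_mult_bounded[OF integrable_shift_diff test_function_measurable[OF \<psi>(1)] \<psi>(2)])
      show "integrable lborel (\<lambda>y. \<bar>f (t *\<^sub>R x + y) - f y\<bar>)" using integrable_shift_diff by simp
      show "(f (t *\<^sub>R x + y) - f y) * \<psi> y \<le> \<bar>f (t *\<^sub>R x + y) - f y\<bar>" for y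
        using mult_left_le[OF \<psi>(2)[of y] abs_ge_zero[of "f (t *\<^sub>R x + y) - f y"]]
        by (simp add: abs_mult[symmetric])
    qed
    finally show ?thesis .
  qed
  then show ?thesis using \<delta>(1) by blast
qed

end

section \<open>Subadditivity, homogeneity and the uniform lower bound\<close>

context
  fixes f :: "'a::euclidean_space \<Rightarrow> real" and D :: "'a set \<Rightarrow> 'a"
  assumes f: "integrable lborel f" and D: "gradient_measure f D"
begin

lemma directional_variation_add_le:
  "directional_variation D (x + y) \<le> directional_variation D x + directional_variation D y"
proof -
  have "ennreal (directional_variation D (x + y)) \<le> ennreal (directional_variation D x) + ennreal (directional_variation D y)"
    using variation_add_le[of "\<lambda>A. D A \<bullet> x" "\<lambda>A. D A \<bullet> y" UNIV]
    by (simp add: variation_eq_directional_variation[OF f D, symmetric] inner_add_right)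
  then show ?thesis
    by (simp add: ennreal_plus[symmetric] directional_variation_nonneg del: ennreal_plus)
qed

lemma directional_variation_le_norm:
  "directional_variation D x \<le> enn2real (variation D UNIV) * norm x"
proof -
  have "variation D UNIV < \<infinity>" using D by (simp add: gradient_measure_def)
  then have "variation D UNIV = ennreal (enn2real (variation D UNIV))" by simp
  then have "ennreal (directional_variation D x) \<le> ennreal (norm x) * ennreal (enn2real (variation D UNIV))"
    using variation_inner_le[of D x UNIV] variation_eq_directional_variation[OF f D, of x] by simp
  then show ?thesis by (simp add: ennreal_mult[symmetric] mult.commute)
qed

lemma directional_variation_scale:
  assumes "0 < c" shows "directional_variation D (c *\<^sub>R x) = c * directional_variation D x"
proof -
  have *: "directional_variation D (c *\<^sub>R x) \<le> c * directional_variation D x" if "0 < c" for c x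
  proof -
    have "variation (\<lambda>A. D A \<bullet> (c *\<^sub>R x)) UNIV \<le> ennreal c * variation (\<lambda>A. D A \<bullet> x) UNIV"
      using that by (intro variation_scaled_le) (auto simp: abs_mult)
    then have "ennreal (directional_variation D (c *\<^sub>R x)) \<le> ennreal (c * directional_variation D x)"
      unfolding variation_eq_directional_variation[OF f D]
      using that by (simp add: ennreal_mult directional_variation_nonneg)
    then show ?thesis using that by (simp add: directional_variation_nonneg)
  qed
  \<comment> \<open>The reverse inequality is the same bound for the factor \<open>inverse c\<close>
    at the vector \<open>c *\<^sub>R x\<close>.\<close>
  have "directional_variation D (inverse c *\<^sub>R (c *\<^sub>R x)) \<le> inverse c * directional_variation D (c *\<^sub>R x)"
    using assms by (intro *) simp
  then have "c * directional_variation D x \<le> directional_variation D (c *\<^sub>R x)"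
    using assms by (simp add: field_simps)
  with *[OF assms] show ?thesis by (rule antisym)
qed

lemma directional_variation_Lipschitz:
  "\<bar>directional_variation D x - directional_variation D y\<bar> \<le> enn2real (variation D UNIV) * norm (x - y)"
  using directional_variation_add_le[of "x - y" y] directional_variation_add_le[of "y - x" x]
    directional_variation_le_norm[of "x - y"] directional_variation_le_norm[of "y - x"]
  by (auto simp: abs_le_iff norm_minus_commute)

lemma continuous_directional_variation: "continuous_on A (directional_variation D)"
proof (rule continuous_on_subset[OF _ subset_UNIV])
  have "(enn2real (variation D UNIV))-lipschitz_on UNIV (directional_variation D)"
    by (rule lipschitz_onI) (auto simp: dist_norm directional_variation_Lipschitz)
  then show "continuous_on UNIV (directional_variation D)"
    by (rule lipschitz_on_continuous_on)
qed

lemma shift_distance_add_le: "shift_distance f (x + y) \<le> shift_distance f x + shift_distance f y"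
proof -
  note [measurable] = borel_measurable_integrable[OF f]
  have int: "integrable lborel (\<lambda>z. \<bar>f (x + z) - f z\<bar>)" for x
    using integrable_shift_diff[OF f D] by simp
  have "shift_distance f (x + y) \<le> (\<integral>z. \<bar>f (x + (y + z)) - f (y + z)\<bar> + \<bar>f (y + z) - f z\<bar> \<partial>lborel)"
    unfolding shift_distance_def
    using int int[of "x + y"] lborel_integrable_shift[OF int[of x], of y] by (intro integral_mono) (auto simp: add.assoc)
  also have "\<dots> = (\<integral>z. \<bar>f (x + (y + z)) - f (y + z)\<bar> \<partial>lborel) + shift_distance f y"
    unfolding shift_distance_def
    using int lborel_integrable_shift[OF int[of x], of y] by simp
  also have "(\<integral>z. \<bar>f (x + (y + z)) - f (y + z)\<bar> \<partial>lborel) = shift_distance f x"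
    unfolding shift_distance_def by (rule lborel_integral_shift[of "\<lambda>z. \<bar>f (x + z) - f z\<bar>"]) measurable
  finally show ?thesis .
qed

text \<open>Controls the energy away from the origin, where the truncated norm may stay bounded and
  a bound linear in \<open>norm x\<close> would not help.\<close>

lemma shift_distance_le_L1: "shift_distance f x \<le> 2 * (\<integral>y. \<bar>f y\<bar> \<partial>lborel)"
proof -
  note [measurable] = borel_measurable_integrable[OF f]
  have "shift_distance f x \<le> (\<integral>y. \<bar>f (x + y)\<bar> + \<bar>f y\<bar> \<partial>lborel)"
    unfolding shift_distance_def
    using f lborel_integrable_shift[OF f] integrable_shift_diff[OF f D] by (intro integral_mono) auto
  also have "\<dots> = (\<integral>y. \<bar>f (x + y)\<bar> \<partial>lborel) + (\<integral>y. \<bar>f y\<bar> \<partial>lborel)"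
    using f lborel_integrable_shift[OF f] by simp
  also have "(\<integral>y. \<bar>f (x + y)\<bar> \<partial>lborel) = (\<integral>y. \<bar>f y\<bar> \<partial>lborel)"
    by (rule lborel_integral_shift[of "\<lambda>y. \<bar>f y\<bar>"]) measurable
  finally show ?thesis by simp
qed

text \<open>On a finite net of the sphere the thresholds have a positive minimum. A third of
  \<open>e\<close> is spent on the lower bound at the net point \<open>\<eta>\<close>, a third on
  moving from \<open>\<eta>\<close> to the direction of \<open>x\<close> in
  \<open>shift_distance\<close>, and a third on the same move in
  \<open>directional_variation\<close>.\<close>

lemma shift_distance_uniform_lower:
  assumes e: "0 < e"
  shows "\<exists>\<delta>>0. \<forall>x. 0 < norm x \<and> norm x < \<delta> \<longrightarrow> directional_variation D x - e * norm x \<le> shift_distance f x"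
proof -
  define K where "K = enn2real (variation D UNIV)"
  have K: "0 \<le> K" by (simp add: K_def)
  \<comment> \<open>A \<open>K\<close>-Lipschitz function changes by at most \<open>K * r\<close>,
    hence by at most \<open>e / 3\<close>, within a ball of the net; \<open>K + 1\<close> keeps the
    denominator positive.\<close>
  define r where "r = e / (3 * (K + 1))"
  have r: "0 < r" using e K by (simp add: r_def)
  have Kr: "K * r \<le> e / 3" using e K by (simp add: r_def field_simps)
  obtain T where T: "finite T" "sphere (0::'a) 1 \<subseteq> (\<Union>\<theta>\<in>T. ball \<theta> r)"
    using compactE_image[of "sphere (0::'a) 1" "sphere (0::'a) 1" "\<lambda>\<theta>. ball \<theta> r"] r
    by (metis UN_I centre_in_ball compact_sphere open_ball subsetI)
  obtain d where d: "\<And>\<theta>. 0 < d \<theta>"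
      "\<And>\<theta> t. 0 < t \<Longrightarrow> t < d \<theta> \<Longrightarrow> t * (directional_variation D \<theta> - e / 3) \<le> shift_distance f (t *\<^sub>R \<theta>)"
    using shift_distance_lower[OF f D, of "e / 3"] e by (metis divide_pos_pos zero_less_numeral)
  \<comment> \<open>The additional element 1 ensures that the minimum is over a nonempty
    set.\<close>
  define \<delta> where "\<delta> = Min (insert 1 (d ` T))"
  have \<delta>: "0 < \<delta>" using T(1) d(1) by (simp add: \<delta>_def)
  have \<delta>_le: "\<delta> \<le> d \<theta>" if "\<theta> \<in> T" for \<theta> using T(1) that by (auto simp: \<delta>_def intro!: Min_le)
  have "directional_variation D x - e * norm x \<le> shift_distance f x" if x: "0 < norm x" "norm x < \<delta>" for x
  proof -
    define t where "t = norm x"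
    define \<theta> where "\<theta> = x /\<^sub>R norm x"
    have x_eq: "x = t *\<^sub>R \<theta>" and t: "0 < t" "t < \<delta>" using x by (auto simp: t_def \<theta>_def)
    have "\<theta> \<in> sphere 0 1" using x by (simp add: \<theta>_def)
    then obtain \<eta> where \<eta>: "\<eta> \<in> T" "dist \<eta> \<theta> < r" using T(2) by auto
    then have nr: "norm (\<eta> - \<theta>) \<le> r" by (simp add: dist_norm)
    have "t * (directional_variation D \<eta> - e / 3) \<le> shift_distance f (t *\<^sub>R \<eta>)"
      using d(2) t \<delta>_le[OF \<eta>(1)] by auto
    also have "\<dots> \<le> shift_distance f (t *\<^sub>R (\<eta> - \<theta>)) + shift_distance f x"
      using shift_distance_add_le[of "t *\<^sub>R (\<eta> - \<theta>)" x] by (simp add: x_eq algebra_simps)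
    \<comment> \<open>The upper bound by \<open>directional_variation\<close> is what makes
      \<open>shift_distance\<close> Lipschitz too.\<close>
    also have "shift_distance f (t *\<^sub>R (\<eta> - \<theta>)) \<le> t * (e / 3)"
    proof -
      have "shift_distance f (t *\<^sub>R (\<eta> - \<theta>)) \<le> t * directional_variation D (\<eta> - \<theta>)"
        using shift_distance_le_directional_variation[OF f D] directional_variation_scale[OF t(1)] by metis
      also have "\<dots> \<le> t * (e / 3)"
        using directional_variation_le_norm[of "\<eta> - \<theta>"] mult_left_mono[OF nr K] Kr t
        by (intro mult_left_mono) (auto simp: K_def)
      finally show ?thesis .
    qed
    finally have 1: "t * (directional_variation D \<eta> - e / 3) \<le> t * (e / 3) + shift_distance f x" by simp
    have "directional_variation D \<theta> - e / 3 \<le> directional_variation D \<eta>"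
      using directional_variation_Lipschitz[of \<eta> \<theta>] mult_left_mono[OF nr K] Kr
      by (auto simp: K_def abs_le_iff)
    then have "t * (directional_variation D \<theta> - e / 3) \<le> t * directional_variation D \<eta>"
      using t by (intro mult_left_mono) auto
    then have "t * directional_variation D \<theta> - e * t \<le> shift_distance f x"
      using 1 by (simp add: algebra_simps)
    then show ?thesis using directional_variation_scale[OF t(1), of \<theta>, folded x_eq] by (simp add: t_def)
  qed
  then show ?thesis using \<delta> by blast
qed

end

subsection \<open>Weak compactness on the sphere\<close>

text \<open>A continuous function of period 2 that is 0 on \<open>[0, 1/3]\<close> and 1 on
  \<open>[2/3, 1]\<close>. Schoenberg's own function is linear between the plateaus; the clipped
  cosine gives continuity and periodicity for free.\<close>

definition schoenberg :: "real \<Rightarrow> real" where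
  "schoenberg t = max 0 (min 1 (1 / 2 - cos (pi * t)))"

lemma schoenberg_bounds: "0 \<le> schoenberg t" "schoenberg t \<le> 1"
  by (auto simp: schoenberg_def)

text \<open>The even integer is a multiple of the period, and \<open>2 * A / 3 + r\<close> lies in
  the plateau of value \<open>A\<close>.\<close>

lemma schoenberg_digit:
  assumes "A \<in> {0, 1::int}" "0 \<le> r" "r \<le> 1 / 3"
  shows "schoenberg (2 * of_int m + 2 * of_int A / 3 + r) = of_int A"
proof -
  let ?s = "2 * of_int A / 3 + r :: real"
  have "cos (pi * (2 * of_int m + 2 * of_int A / 3 + r)) = cos (pi * ?s + 2 * pi * of_int m)"
    by (simp add: algebra_simps)
  also have "\<dots> = cos (pi * ?s)"
    by (simp add: cos_add sin_int_2pin cos_int_2pin)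
  finally have c: "cos (pi * (2 * of_int m + 2 * of_int A / 3 + r)) = cos (pi * ?s)" .
  consider "A = 0" | "A = 1" using assms(1) by auto
  then show ?thesis
  proof cases
    case 1
    have "cos (pi / 3) \<le> cos (pi * r)"
      using assms mult_left_mono[of r "1/3" pi] by (intro cos_monotone_0_pi_le) auto
    then show ?thesis using 1 c by (simp add: schoenberg_def cos_60)
  next
    case 2
    have "cos (pi * (2 / 3 + r)) \<le> cos (pi * (2 / 3))"
      using assms mult_left_mono[of "2/3 + r" 1 pi] by (intro cos_monotone_0_pi_le mult_left_mono) auto
    also have "cos (pi * (2 / 3)) = - (1 / 2)"
    proof -
      have "pi * (2 / 3) = pi - pi / 3" by (simp add: field_simps)
      then show ?thesis by (simp only: cos_pi_minus) (simp add: cos_60)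
    qed
    finally show ?thesis using 2 c by (simp add: schoenberg_def)
  qed
qed

lemma geometric_two_thirds_sums: "(\<lambda>m. 2 / 3 * (1 / 3) ^ m :: real) sums 1"
  using sums_mult[OF geometric_sums[of "1 / 3 :: real"], of "2/3"] by simp

context
  fixes A :: "nat \<Rightarrow> int"
  assumes A: "\<And>n. A n \<in> {0, 1}"
begin

lemma ternary_term_bounds:
  "0 \<le> 2 * real_of_int (A m) / 3 ^ Suc m" "2 * real_of_int (A m) / 3 ^ Suc m \<le> 2 / 3 * (1 / 3) ^ m"
  using A[of m] by (auto simp: power_one_over field_simps)

lemma ternary_summable: "summable (\<lambda>m. 2 * real_of_int (A m) / 3 ^ Suc m)"
proof (rule summable_comparison_test'[OF sums_summable[OF geometric_two_thirds_sums], of 0])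
  show "norm (2 * real_of_int (A m) / 3 ^ Suc m) \<le> 2 / 3 * (1 / 3) ^ m" for m
    unfolding real_norm_def abs_of_nonneg[OF ternary_term_bounds(1)] by (rule ternary_term_bounds(2))
qed

lemma ternary_suminf_bounds:
  "0 \<le> (\<Sum>m. 2 * real_of_int (A m) / 3 ^ Suc m)" "(\<Sum>m. 2 * real_of_int (A m) / 3 ^ Suc m) \<le> 1"
  using suminf_nonneg[OF ternary_summable ternary_term_bounds(1)]
    suminf_le[OF ternary_term_bounds(2) ternary_summable sums_summable[OF geometric_two_thirds_sums]]
    sums_unique[OF geometric_two_thirds_sums]
  by simp_all

text \<open>Multiplication by \<open>3 ^ n\<close> turns the first \<open>n\<close> ternary digits,
  all of them 0 or 2, into an even integer. Digit \<open>n\<close> then selects the plateau, and the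
  tail \<open>r\<close> of the expansion is at most 1/3.\<close>

lemma schoenberg_ternary:
  "schoenberg (3 ^ n * (\<Sum>m. 2 * of_int (A m) / 3 ^ Suc m)) = of_int (A n)"
proof -
  let ?a = "\<lambda>m. 2 * of_int (A m) / 3 ^ Suc m :: real"
  note le = ternary_term_bounds and geo = geometric_two_thirds_sums and summ = ternary_summable
  define r where "r = 3 ^ n * (\<Sum>m. ?a (m + Suc n))"
  have "(\<Sum>m. ?a m) = (\<Sum>m. ?a (m + Suc n)) + (\<Sum>m<Suc n. ?a m)"
    by (rule suminf_split_initial_segment[OF summ])
  then have "3 ^ n * (\<Sum>m. ?a m) = r + 3 ^ n * (\<Sum>m<n. ?a m) + 2 * of_int (A n) / 3"
    by (simp add: r_def algebra_simps)
  also have "3 ^ n * (\<Sum>m<n. ?a m) = 2 * of_int (\<Sum>m<n. A m * 3 ^ (n - Suc m))"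
  proof -
    have "3 ^ n * ?a m = 2 * (of_int (A m) * 3 ^ (n - Suc m))" if "m < n" for m
    proof -
      have "(3::real) ^ n = 3 ^ (n - Suc m) * 3 ^ Suc m" using that by (simp add: power_add[symmetric] del: power_Suc)
      then show ?thesis by simp
    qed
    then show ?thesis by (simp add: sum_distrib_left)
  qed
  finally have eq: "3 ^ n * (\<Sum>m. ?a m) = 2 * of_int (\<Sum>m<n. A m * 3 ^ (n - Suc m)) + 2 * of_int (A n) / 3 + r"
    by simp
  have summ': "summable (\<lambda>m. ?a (m + Suc n))" using summ by (rule summable_ignore_initial_segment)
  have "0 \<le> r" unfolding r_def by (intro mult_nonneg_nonneg suminf_nonneg summ' le) simp
  moreover have "r \<le> 1 / 3"
  proof -
    have "(\<Sum>m. ?a (m + Suc n)) \<le> (\<Sum>m. (1 / 3) ^ Suc n * (2 / 3 * (1 / 3) ^ m))"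
    proof (rule suminf_le[OF _ summ'])
      show "?a (m + Suc n) \<le> (1 / 3) ^ Suc n * (2 / 3 * (1 / 3) ^ m)" for m
        using le(2)[of "m + Suc n"] by (simp add: power_add mult_ac)
      show "summable (\<lambda>m. (1 / 3) ^ Suc n * (2 / 3 * (1 / 3 :: real) ^ m))"
        using geo by (intro summable_mult sums_summable)
    qed
    also have "\<dots> = (1 / 3) ^ Suc n"
      using sums_mult[OF geo, of "(1 / 3) ^ Suc n"] by (simp add: sums_iff)
    finally have "r \<le> 3 ^ n * (1 / 3) ^ Suc n" unfolding r_def by (intro mult_left_mono) auto
    then show ?thesis by (simp add: power_one_over)
  qed
  ultimately show ?thesis unfolding eq by (rule schoenberg_digit[OF A])
qed

end

definition binary_digit :: "nat \<Rightarrow> real \<Rightarrow> int" where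
  "binary_digit k x = \<lfloor>2 ^ Suc k * x\<rfloor> mod 2"

lemma binary_digit_range: "binary_digit k x \<in> {0, 1}"
  unfolding binary_digit_def by auto

text \<open>The partial sums are \<open>x\<close> rounded down to multiples of
  \<open>1 / 2 ^ n\<close>; \<open>x < 1\<close> is what makes the integer part vanish.\<close>

lemma binary_digit_sums:
  assumes "0 \<le> x" "x < 1"
  shows "(\<lambda>k. of_int (binary_digit k x) / 2 ^ Suc k) sums x"
proof -
  have partial: "(\<Sum>k<n. real_of_int (binary_digit k x) / 2 ^ Suc k) = of_int \<lfloor>2 ^ n * x\<rfloor> / 2 ^ n" for n
  proof (induction n)
    case 0
    have "\<lfloor>x\<rfloor> = 0" using assms by linarith
    then show ?case by simp
  next
    case (Suc n)
    have "\<lfloor>2 ^ Suc n * x\<rfloor> div 2 = \<lfloor>2 ^ n * x\<rfloor>"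
      using floor_divide_real_eq_div[of 2 "2 ^ Suc n * x"] by simp
    then have "\<lfloor>2 ^ Suc n * x\<rfloor> = 2 * \<lfloor>2 ^ n * x\<rfloor> + binary_digit n x"
      unfolding binary_digit_def by (metis mult_div_mod_eq)
    then have "(of_int \<lfloor>2 ^ Suc n * x\<rfloor> :: real) = 2 * of_int \<lfloor>2 ^ n * x\<rfloor> + of_int (binary_digit n x)"
      by simp
    then show ?case using Suc by (simp add: field_simps)
  qed
  have "(\<lambda>n. of_int \<lfloor>2 ^ n * x\<rfloor> / 2 ^ n) \<longlonglongrightarrow> x"
  proof (rule LIM_zero_cancel, rule Lim_null_comparison)
    show "\<forall>\<^sub>F n in sequentially. norm (of_int \<lfloor>2 ^ n * x\<rfloor> / 2 ^ n - x) \<le> (1 / 2) ^ n"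
    proof (rule always_eventually, rule allI)
      fix n :: nat
      have "\<bar>of_int \<lfloor>2 ^ n * x\<rfloor> - 2 ^ n * x\<bar> \<le> 1" by linarith
      moreover have "of_int \<lfloor>2 ^ n * x\<rfloor> / 2 ^ n - x = (of_int \<lfloor>2 ^ n * x\<rfloor> - 2 ^ n * x) / 2 ^ n"
        by (simp add: diff_divide_distrib)
      ultimately show "norm (of_int \<lfloor>2 ^ n * x\<rfloor> / 2 ^ n - x) \<le> (1 / 2) ^ n"
        by (simp add: power_one_over divide_right_mono abs_divide)
    qed
    show "(\<lambda>n. (1 / 2 :: real) ^ n) \<longlonglongrightarrow> 0" by (simp add: LIMSEQ_power_zero)
  qed
  then show ?thesis unfolding sums_def partial .
qed

text \<open>Schoenberg's space-filling curve: the ternary digits of the parameter are distributed over the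
  coordinates, where they serve as binary digits.\<close>

lemma curve_with_measurable_section:
  obtains c :: "real \<Rightarrow> 'a::euclidean_space" and s :: "'a \<Rightarrow> real"
  where "continuous_on UNIV c" "s \<in> borel_measurable borel" "\<And>x. 0 \<le> s x" "\<And>x. s x \<le> 1"
    "\<And>x. norm x \<le> 1 \<Longrightarrow> c (s x) = x"
proof -
  define d where "d = DIM('a)"
  have d: "0 < d" by (simp add: d_def)
  obtain i :: "'a \<Rightarrow> nat" where i: "bij_betw i Basis {0..<d}"
    unfolding d_def using ex_bij_betw_finite_nat[OF finite_Basis] by blast
  define c0 where "c0 b t = (\<Sum>k. schoenberg (3 ^ (k * d + i b) * t) / 2 ^ Suc k)" for b t
  \<comment> \<open>Position \<open>k * d + i b\<close> holds binary digit \<open>k\<close> of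
    coordinate \<open>b\<close>. The affine map sends \<open>[-1, 1]\<close> to
    \<open>[0, 1/2]\<close>, away from 1, where the binary expansion would fail; the factor 4 and
    the shift by 1 in \<open>c\<close> undo it.\<close>
  define A where "A n x = binary_digit (n div d) ((x \<bullet> inv_into Basis i (n mod d) + 1) / 4)" for n x
  define s where "s x = (\<Sum>n. 2 * of_int (A n x) / 3 ^ Suc n :: real)" for x
  define c where "c t = (\<Sum>b\<in>Basis. (4 * c0 b t - 1) *\<^sub>R b)" for t
  have A01: "A n x \<in> {0, 1}" for n x unfolding A_def by (rule binary_digit_range)
  have "continuous_on UNIV (c0 b)" for b
  proof (rule uniform_limit_theorem)
    show "uniform_limit UNIV (\<lambda>n t. \<Sum>k<n. schoenberg (3 ^ (k * d + i b) * t) / 2 ^ Suc k) (c0 b) sequentially"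
      unfolding c0_def
    proof (rule Weierstrass_m_test)
      show "norm (schoenberg (3 ^ (k * d + i b) * t) / 2 ^ Suc k) \<le> (1 / 2) ^ Suc k" for k t
        using schoenberg_bounds[of "3 ^ (k * d + i b) * t"]
        by (simp add: power_one_over field_simps)
      show "summable (\<lambda>k. (1 / 2 :: real) ^ Suc k)"
        using power_half_series sums_summable by blast
    qed
    show "\<forall>\<^sub>F n in sequentially. continuous_on UNIV (\<lambda>t. \<Sum>k<n. schoenberg (3 ^ (k * d + i b) * t) / 2 ^ Suc k)"
      unfolding schoenberg_def by (intro always_eventually allI continuous_intros) auto
  qed simp
  then have "continuous_on UNIV c" unfolding c_def by (intro continuous_intros) auto
  moreover have "s \<in> borel_measurable borel"
    unfolding s_def A_def binary_digit_def by measurable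
  moreover have s01: "0 \<le> s x \<and> s x \<le> 1" for x
    unfolding s_def using ternary_suminf_bounds[of "\<lambda>n. A n x", OF A01] by blast
  moreover have "c (s x) = x" if "norm x \<le> 1" for x
  proof -
    have c0: "c0 b (s x) = (x \<bullet> b + 1) / 4" if b: "b \<in> Basis" for b
    proof -
      have ib: "i b < d" using i b by (auto simp: bij_betw_def)
      have "A (k * d + i b) x = binary_digit k ((x \<bullet> b + 1) / 4)" for k
        using ib d i b by (simp add: A_def bij_betw_def inv_into_f_f)
      moreover have "schoenberg (3 ^ n * s x) = of_int (A n x)" for n
        unfolding s_def by (rule schoenberg_ternary[of "\<lambda>n. A n x", OF A01])
      moreover have "\<bar>x \<bullet> b\<bar> \<le> 1" using Basis_le_norm[OF b, of x] \<open>norm x \<le> 1\<close> by linarith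
      ultimately show ?thesis
        unfolding c0_def using binary_digit_sums[of "(x \<bullet> b + 1) / 4"] by (simp add: sums_iff abs_le_iff)
    qed
    have "4 * c0 b (s x) - 1 = x \<bullet> b" if "b \<in> Basis" for b unfolding c0[OF that] by (simp add: field_simps)
    then have "c (s x) = (\<Sum>b\<in>Basis. (x \<bullet> b) *\<^sub>R b)" unfolding c_def by (intro sum.cong) simp_all
    then show ?thesis by (simp add: euclidean_representation)
  qed
  ultimately show thesis using that by blast
qed

text \<open>Since \<open>c (s x) = x\<close> on the sphere, the integral of \<open>h\<close> over
  \<open>M n\<close> equals that of \<open>h \<circ> c\<close> over the law of \<open>s\<close>, and
  \<open>h \<circ> c\<close> is continuous. What remains is that \<open>c\<close> carries the limit
  law to the sphere, which is not automatic because \<open>c\<close> takes values outside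
  it.\<close>

lemma sphere_weakly_compact:
  fixes M :: "nat \<Rightarrow> 'a::euclidean_space measure"
  assumes M: "\<And>n. prob_space (M n)" "\<And>n. sets (M n) = sets sphere_borel"
  obtains r \<mu> where "strict_mono r" "prob_space \<mu>" "sets \<mu> = sets sphere_borel" "weak_limit (\<lambda>n. M (r n)) \<mu>"
proof -
  obtain c :: "real \<Rightarrow> 'a" and s :: "'a \<Rightarrow> real" where c: "continuous_on UNIV c"
    and [measurable]: "s \<in> borel_measurable borel" and s: "\<And>x. 0 \<le> s x" "\<And>x. s x \<le> 1"
    and cs: "\<And>x. norm x \<le> 1 \<Longrightarrow> c (s x) = x"
    using curve_with_measurable_section by blast
  have spM: "space (M n) = sphere 0 1" for n
    using sets_eq_imp_space_eq[OF M(2)] by (simp add: space_restrict_space)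
  have sM[measurable]: "s \<in> borel_measurable (M n)" for n
    unfolding measurable_cong_sets[OF M(2) refl] by (rule measurable_restrict_space1) simp
  have [measurable]: "c \<in> borel_measurable borel" by (rule borel_measurable_continuous_onI[OF c])
  define Q where "Q n = distr (M n) borel s" for n
  have Q: "real_distribution (Q n)" for n
    unfolding Q_def using M(1) sM by (intro real_distribution.intro prob_space.prob_space_distr real_distribution_axioms.intro) auto
  \<comment> \<open>Tightness is phrased with half-open intervals, and \<open>s\<close> may take the
    value 0; hence the left endpoint -1.\<close>
  have "measure (Q n) {-1<..1} = 1" for n
  proof -
    have "-1 < s x" for x using s(1)[of x] by linarith
    then have "s -` {-1<..1} \<inter> space (M n) = space (M n)" using s(2) by auto
    then show ?thesis unfolding Q_def using prob_space.prob_space[OF M(1)] by (simp add: measure_distr)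
  qed
  then have "tight Q" unfolding tight_def using Q
    by (intro conjI allI impI exI[of _ "-1"] exI[of _ 1]) auto
  then obtain r Q' where r: "strict_mono r" and Q': "real_distribution Q'" and conv: "weak_conv_m (Q \<circ> id \<circ> r) Q'"
    using tight_imp_convergent_subsubsequence strict_mono_id by blast
  interpret Q': real_distribution Q' by fact
  have lim: "(\<lambda>n. \<integral>x. h x \<partial>M (r n)) \<longlonglongrightarrow> (\<integral>t. h (c t) \<partial>Q')"
    if h: "continuous_on UNIV h" "\<And>x. \<bar>h x\<bar> \<le> B" for h :: "'a \<Rightarrow> real" and B
  proof -
    have [measurable]: "h \<in> borel_measurable borel" by (rule borel_measurable_continuous_onI[OF h(1)])
    have "(\<lambda>n. \<integral>t. h (c t) \<partial>(Q \<circ> id \<circ> r) n) \<longlonglongrightarrow> (\<integral>t. h (c t) \<partial>Q')"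
    proof (rule weak_conv_imp_integral_bdd_continuous_conv[OF _ Q' conv])
      show "real_distribution ((Q \<circ> id \<circ> r) n)" for n using Q by simp
      have "continuous_on UNIV (\<lambda>t. h (c t))"
        by (rule continuous_on_compose2[OF h(1) c]) auto
      then show "isCont (\<lambda>t. h (c t)) t" for t by (simp add: continuous_on_eq_continuous_at)
      show "norm (h (c t)) \<le> B" for t using h(2) by simp
    qed
    moreover have "(\<integral>t. h (c t) \<partial>(Q \<circ> id \<circ> r) n) = (\<integral>x. h x \<partial>M (r n))" for n
    proof -
      have "(\<integral>t. h (c t) \<partial>(Q \<circ> id \<circ> r) n) = (\<integral>x. h (c (s x)) \<partial>M (r n))"
        unfolding Q_def comp_def id_def by (rule integral_distr) measurable
      also have "\<dots> = (\<integral>x. h x \<partial>M (r n))"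
        by (intro Bochner_Integration.integral_cong refl) (simp add: spM cs)
      finally show ?thesis .
    qed
    ultimately show ?thesis by simp
  qed
  have ne: "sphere (0::'a) 1 \<noteq> {}" by simp
  obtain e0 :: 'a where e0: "e0 \<in> sphere 0 1" using ne by blast
  \<comment> \<open>A bounded continuous function vanishing exactly on the sphere. Its integrals
    over all \<open>M n\<close> are 0, so the limit is 0, which puts \<open>c t\<close> on the
    sphere for almost every \<open>t\<close>.\<close>
  let ?h = "\<lambda>x. min 1 (infdist x (sphere (0::'a) 1))"
  have hcont: "continuous_on UNIV ?h" by (intro continuous_intros)
  have hmeas[measurable]: "?h \<in> borel_measurable borel" by (rule borel_measurable_continuous_onI[OF hcont])
  have "(\<integral>x. ?h x \<partial>M n) = 0" for n
  proof -
    have "(\<integral>x. ?h x \<partial>M n) = (\<integral>x. 0 \<partial>M n)"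
      by (intro Bochner_Integration.integral_cong refl) (simp add: spM)
    then show ?thesis by simp
  qed
  moreover have "(\<lambda>n. \<integral>x. ?h x \<partial>M (r n)) \<longlonglongrightarrow> (\<integral>t. ?h (c t) \<partial>Q')"
    by (rule lim[OF hcont, of 1]) (simp add: infdist_nonneg)
  ultimately have "(\<integral>t. ?h (c t) \<partial>Q') = 0" by (simp add: LIMSEQ_const_iff)
  moreover have "integrable Q' (\<lambda>t. ?h (c t))"
    by (rule Q'.integrable_const_bound[of _ 1]) (auto simp: infdist_nonneg)
  ultimately have "AE t in Q'. ?h (c t) = 0"
    by (subst (asm) integral_nonneg_eq_0_iff_AE) (auto simp: infdist_nonneg)
  then have AE: "AE t in Q'. c t \<in> sphere 0 1"
  proof eventually_elim
    case (elim t)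
    then have "infdist (c t) (sphere (0::'a) 1) = 0" by (simp add: min_def split: if_splits)
    then show ?case using in_closed_iff_infdist_zero[OF closed_sphere ne] by blast
  qed
  \<comment> \<open>The exceptional parameters form a null set and are sent to \<open>e0\<close>, so
    that the image measure can be formed on the sphere itself.\<close>
  define c' where "c' t = (if norm (c t) = 1 then c t else e0)" for t
  have [measurable]: "c' \<in> borel_measurable borel" unfolding c'_def by measurable
  have c'm: "c' \<in> measurable Q' sphere_borel"
    by (rule measurable_restrict_space2) (use e0 in \<open>auto simp: c'_def\<close>)
  define \<mu> where "\<mu> = distr Q' sphere_borel c'"
  have sp\<mu>: "space \<mu> = sphere 0 1" by (simp add: \<mu>_def space_restrict_space)
  have "weak_limit (\<lambda>n. M (r n)) \<mu>"
    unfolding weak_limit_def sp\<mu>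
  proof (intro allI impI)
    fix g :: "'a \<Rightarrow> real" assume g: "continuous_on (sphere 0 1) g" "bounded (g ` sphere 0 1)"
    then obtain B where B: "\<And>x. x \<in> sphere 0 1 \<Longrightarrow> norm (g x) \<le> B" unfolding bounded_iff by blast
    have "0 \<le> B" using B[OF e0] norm_ge_zero order_trans by blast
    \<comment> \<open>The convergence \<open>lim\<close> concerns functions on the whole space; the
      extension by Tietze's theorem keeps the bound \<open>B\<close>.\<close>
    obtain G where G: "continuous_on UNIV G" "\<And>x. x \<in> sphere 0 1 \<Longrightarrow> G x = g x" "\<And>x. norm (G x) \<le> B"
      using Tietze[OF g(1) _ \<open>0 \<le> B\<close> B, of UNIV] by auto
    have [measurable]: "G \<in> borel_measurable borel" by (rule borel_measurable_continuous_onI[OF G(1)])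
    have "(\<lambda>n. \<integral>x. G x \<partial>M (r n)) \<longlonglongrightarrow> (\<integral>t. G (c t) \<partial>Q')"
      by (rule lim[OF G(1), of B]) (use G(3) in simp)
    moreover have "(\<integral>x. G x \<partial>M n) = (\<integral>x. g x \<partial>M n)" for n
      by (intro Bochner_Integration.integral_cong refl) (simp add: spM G)
    moreover have "(\<integral>t. G (c t) \<partial>Q') = (\<integral>x. g x \<partial>\<mu>)"
    proof -
      have "g \<in> borel_measurable sphere_borel"
        by (rule borel_measurable_continuous_on_restrict[OF g(1)])
      then have "(\<integral>x. g x \<partial>\<mu>) = (\<integral>t. g (c' t) \<partial>Q')"
        unfolding \<mu>_def by (rule integral_distr[OF c'm])
      also have "\<dots> = (\<integral>t. G (c' t) \<partial>Q')"
        using e0 by (intro Bochner_Integration.integral_cong refl) (simp add: G c'_def)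
      also have "\<dots> = (\<integral>t. G (c t) \<partial>Q')"
        using AE by (intro integral_cong_AE) (auto simp: c'_def elim!: eventually_mono)
      finally show ?thesis ..
    qed
    ultimately show "(\<lambda>n. \<integral>x. g x \<partial>M (r n)) \<longlonglongrightarrow> (\<integral>x. g x \<partial>\<mu>)" by simp
  qed
  moreover have "prob_space \<mu>" unfolding \<mu>_def by (rule Q'.prob_space_distr[OF c'm])
  ultimately show thesis using that[OF r] by (simp add: \<mu>_def)
qed

subsection \<open>The rescaled energy\<close>

text \<open>\<open>R\<close> may be infinite, but the minimum with \<open>norm x\<close> is always
  finite, so it can be taken as a real number and used as a divisor.\<close>

definition truncated_norm :: "ennreal \<Rightarrow> 'a::euclidean_space \<Rightarrow> real" where
  "truncated_norm R x = enn2real (min R (ennreal (norm x)))"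

lemma measurable_truncated_norm[measurable]: "truncated_norm R \<in> borel_measurable borel"
  unfolding truncated_norm_def[abs_def] by measurable

lemma ennreal_truncated_norm: "ennreal (truncated_norm R x) = min R (ennreal (norm x))"
proof -
  have "min R (ennreal (norm x)) < \<top>" by (simp add: min_less_iff_disj)
  then show ?thesis unfolding truncated_norm_def by simp
qed

lemma truncated_norm_nonneg: "0 \<le> truncated_norm R x"
  by (simp add: truncated_norm_def)

lemma truncated_norm_pos:
  assumes "1 \<le> R" "x \<noteq> 0" shows "0 < truncated_norm R x"
proof -
  have "0 < min R (ennreal (norm x))" using assms by (auto simp: min_def intro: less_le_trans[of 0 1])
  then show ?thesis using ennreal_truncated_norm[of R x] by (metis ennreal_less_zero_iff)
qed

lemma truncated_norm_eq_norm:
  assumes "1 \<le> R" "norm x \<le> 1" shows "truncated_norm R x = norm x"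
proof -
  have "ennreal (norm x) \<le> 1" using assms(2) by (simp add: ennreal_le_1)
  then have "ennreal (norm x) \<le> R" using assms(1) by (rule order_trans)
  then show ?thesis by (simp add: truncated_norm_def min_absorb2)
qed

lemma truncated_norm_ge_1:
  assumes "1 \<le> R" "1 \<le> norm x" shows "1 \<le> truncated_norm R x"
proof -
  have "1 \<le> ennreal (norm x)" using assms(2) by (simp add: ennreal_ge_1)
  then have "1 \<le> ennreal (truncated_norm R x)" using assms(1) by (simp add: ennreal_truncated_norm)
  then show ?thesis by (simp add: ennreal_ge_1)
qed

context
  fixes \<nu> :: "'a::euclidean_space measure" and R :: ennreal
  assumes borel: "sets \<nu> = sets borel" and R_ge: "1 \<le> R"
    and C_pos: "0 < truncated_moment R \<nu>" and C_finite: "truncated_moment R \<nu> < \<infinity>"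
begin

private lemma sets_nu[measurable_cong]: "sets \<nu> = sets borel" by (fact borel)

lemma sets_rescaled_measure: "sets (rescaled_measure R \<nu>) = sets borel"
  by (simp add: rescaled_measure_def borel)

private lemma sets_lambda[measurable_cong]: "sets (rescaled_measure R \<nu>) = sets borel"
  by (fact sets_rescaled_measure)

lemma space_rescaled_measure: "space (rescaled_measure R \<nu>) = UNIV"
  using sets_eq_imp_space_eq[OF sets_rescaled_measure] by simp

private lemma C_inverse: "inverse (truncated_moment R \<nu>) * truncated_moment R \<nu> = 1"
proof -
  have "truncated_moment R \<nu> / truncated_moment R \<nu> = 1"
    using C_pos C_finite by (intro ennreal_divide_self) auto
  then show ?thesis by (simp add: divide_ennreal_def mult.commute)
qed

lemma nn_integral_rescaled_measure:
  assumes [measurable]: "h \<in> borel_measurable borel"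
  shows "(\<integral>\<^sup>+x. h x \<partial>rescaled_measure R \<nu>) =
    inverse (truncated_moment R \<nu>) * (\<integral>\<^sup>+x. min R (ennreal (norm x)) * h x \<partial>\<nu>)"
  unfolding rescaled_measure_def
  by (subst nn_integral_density) (auto simp: mult.assoc nn_integral_cmult)

lemma prob_space_rescaled_measure: "prob_space (rescaled_measure R \<nu>)"
proof
  have "emeasure (rescaled_measure R \<nu>) (space (rescaled_measure R \<nu>)) = (\<integral>\<^sup>+x. 1 \<partial>rescaled_measure R \<nu>)"
    by simp
  also have "\<dots> = 1"
    by (subst nn_integral_rescaled_measure) (auto simp: truncated_moment_def[symmetric] C_inverse)
  finally show "emeasure (rescaled_measure R \<nu>) (space (rescaled_measure R \<nu>)) = 1" .
qed

text \<open>The density vanishes at the origin.\<close>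

lemma rescaled_measure_AE_nonzero: "AE x in rescaled_measure R \<nu>. x \<noteq> 0"
  unfolding rescaled_measure_def by (subst AE_density) auto

text \<open>Dividing by the truncated norm trades \<open>\<nu>\<close> for the rescaled measure.
  That is a probability measure, so the order of integration may be exchanged, and the integral over
  \<open>y\<close> becomes the shift distance.\<close>

lemma nonlocal_energy_eq:
  fixes f :: "'a \<Rightarrow> real"
  assumes f: "integrable lborel f"
  shows "inverse (truncated_moment R \<nu>) * nonlocal_energy \<nu> f =
    1 / 2 * (\<integral>\<^sup>+x. ennreal (shift_distance f x / truncated_norm R x) \<partial>rescaled_measure R \<nu>)"
proof -
  let ?M = "rescaled_measure R \<nu>" and ?C = "truncated_moment R \<nu>"
  have [measurable]: "f \<in> borel_measurable borel" using borel_measurable_integrable[OF f] by simp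
  interpret L: prob_space ?M by (rule prob_space_rescaled_measure)
  interpret P: pair_sigma_finite ?M lborel
    by (intro pair_sigma_finite.intro L.sigma_finite_measure_axioms sigma_finite_lborel)
  have inner: "(\<integral>\<^sup>+x. ennreal \<bar>f (x + y) - f y\<bar> \<partial>\<nu>) =
      ?C * (\<integral>\<^sup>+x. ennreal (\<bar>f (x + y) - f y\<bar> / truncated_norm R x) \<partial>?M)" for y
  proof -
    \<comment> \<open>At the origin both sides vanish, as the translate is then \<open>f\<close>
      itself; elsewhere the truncated norm is positive and cancels.\<close>
    have "min R (ennreal (norm x)) * ennreal (\<bar>f (x + y) - f y\<bar> / truncated_norm R x) = ennreal \<bar>f (x + y) - f y\<bar>" for x
    proof (cases "x = 0")
      case False
      then show ?thesis using truncated_norm_pos[OF R_ge False]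
        by (simp add: ennreal_truncated_norm[symmetric] ennreal_mult[symmetric])
    qed simp
    then have "(\<integral>\<^sup>+x. ennreal (\<bar>f (x + y) - f y\<bar> / truncated_norm R x) \<partial>?M) =
        inverse ?C * (\<integral>\<^sup>+x. ennreal \<bar>f (x + y) - f y\<bar> \<partial>\<nu>)"
      by (subst nn_integral_rescaled_measure) auto
    then show ?thesis using C_inverse by (simp add: mult.assoc[symmetric] mult.commute)
  qed
  have "(\<integral>\<^sup>+y. (\<integral>\<^sup>+x. ennreal \<bar>f (x + y) - f y\<bar> \<partial>\<nu>) \<partial>lborel) =
      ?C * (\<integral>\<^sup>+y. (\<integral>\<^sup>+x. ennreal (\<bar>f (x + y) - f y\<bar> / truncated_norm R x) \<partial>?M) \<partial>lborel)"
    unfolding inner by (rule nn_integral_cmult) measurable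
  also have "(\<integral>\<^sup>+y. (\<integral>\<^sup>+x. ennreal (\<bar>f (x + y) - f y\<bar> / truncated_norm R x) \<partial>?M) \<partial>lborel) =
      (\<integral>\<^sup>+x. (\<integral>\<^sup>+y. ennreal (\<bar>f (x + y) - f y\<bar> / truncated_norm R x) \<partial>lborel) \<partial>?M)"
    by (rule P.Fubini') measurable
  also have "\<dots> = (\<integral>\<^sup>+x. ennreal (shift_distance f x / truncated_norm R x) \<partial>?M)"
  proof (intro nn_integral_cong)
    fix x
    have "integrable lborel (\<lambda>y. f (x + y) - f y)" using lborel_integrable_shift[OF f] f by simp
    then show "(\<integral>\<^sup>+y. ennreal (\<bar>f (x + y) - f y\<bar> / truncated_norm R x) \<partial>lborel) =
        ennreal (shift_distance f x / truncated_norm R x)"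
      unfolding shift_distance_def
      by (subst nn_integral_eq_integral) (auto simp: truncated_norm_nonneg)
  qed
  finally have "inverse ?C * nonlocal_energy \<nu> f = 1 / 2 * ((inverse ?C * ?C) *
      (\<integral>\<^sup>+x. ennreal (shift_distance f x / truncated_norm R x) \<partial>?M))"
    unfolding nonlocal_energy_def by (simp add: mult_ac)
  then show ?thesis by (simp add: C_inverse)
qed

text \<open>A cone over \<open>E\<close> is the preimage of \<open>E\<close> under radial
  projection; \<open>e0\<close> is a default value at the origin, which is a null set. As an image
  measure the angular measure admits change of variables in integrals.\<close>

lemma angular_measure_eq_distr:
  assumes e0: "norm e0 = 1"
  shows "angular_measure (rescaled_measure R \<nu>) =
    distr (rescaled_measure R \<nu>) sphere_borel (\<lambda>x. if x = 0 then e0 else x /\<^sub>R norm x)"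
    and "(\<lambda>x. if x = 0 then e0 else x /\<^sub>R norm x) \<in> measurable (rescaled_measure R \<nu>) sphere_borel"
proof -
  let ?M = "rescaled_measure R \<nu>" and ?n = "\<lambda>x. if x = 0 then e0 else x /\<^sub>R norm x"
  show n: "?n \<in> measurable ?M sphere_borel"
    by (rule measurable_restrict_space2) (use e0 in auto)
  show "angular_measure ?M = distr ?M sphere_borel ?n"
  proof (rule measure_eqI)
    have sa: "sets (angular_measure ?M) = sets sphere_borel"
      unfolding angular_measure_def
      using sets.sigma_sets_eq[of "sphere_borel :: 'a measure"] sets.space_closed[of "sphere_borel :: 'a measure"]
      by (simp add: space_restrict_space)
    then show "sets (angular_measure ?M) = sets (distr ?M sphere_borel ?n)" by simp
    fix E assume "E \<in> sets (angular_measure ?M)"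
    then have E: "E \<in> sets sphere_borel" using sa by simp
    then have sub: "E \<subseteq> sphere 0 1" and E': "E \<in> sets borel" by (auto simp: sets_restrict_space_iff)
    note [measurable] = E'
    have meas: "{x::'a \<in> space borel. x \<noteq> 0 \<and> x /\<^sub>R norm x \<in> E} \<in> sets borel" by measurable
    have "emeasure (angular_measure ?M) E = emeasure ?M (open_cone E)"
      by (rule emeasure_angular_measure[OF sets_rescaled_measure E])
    also have "\<dots> = emeasure ?M (?n -` E \<inter> space ?M)"
    proof (rule emeasure_eq_AE)
      show "AE x in ?M. x \<in> open_cone E \<longleftrightarrow> x \<in> ?n -` E \<inter> space ?M"
        using rescaled_measure_AE_nonzero
        by eventually_elim (simp add: open_cone_eq[OF sub] space_rescaled_measure)
      show "open_cone E \<in> sets ?M"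
        using meas by (simp add: open_cone_eq[OF sub] sets_rescaled_measure)
    qed (rule measurable_sets[OF n E])
    also have "\<dots> = emeasure (distr ?M sphere_borel ?n) E"
      by (rule emeasure_distr[OF n E, symmetric])
    finally show "emeasure (angular_measure ?M) E = emeasure (distr ?M sphere_borel ?n) E" .
  qed
qed

lemma prob_space_angular_measure:
  "prob_space (angular_measure (rescaled_measure R \<nu>))"
  "sets (angular_measure (rescaled_measure R \<nu>)) = sets sphere_borel"
proof -
  obtain e0 :: 'a where e0: "norm e0 = 1" using vector_choose_size[of 1] by auto
  show "prob_space (angular_measure (rescaled_measure R \<nu>))"
    unfolding angular_measure_eq_distr(1)[OF e0]
    by (rule prob_space.prob_space_distr[OF prob_space_rescaled_measure angular_measure_eq_distr(2)[OF e0]])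
  show "sets (angular_measure (rescaled_measure R \<nu>)) = sets sphere_borel"
    unfolding angular_measure_eq_distr(1)[OF e0] by simp
qed

text \<open>For \<open>norm x \<le> \<delta>\<close> the truncated norm is \<open>norm x\<close>,
  because \<open>\<delta> \<le> 1 \<le> R\<close>, and by homogeneity \<open>q x\<close> lies
  between \<open>directional_variation D\<close> at \<open>x / norm x\<close> and that value minus
  \<open>e\<close>. Farther out both quantities lie between 0 and \<open>K\<close>: the first
  summand of \<open>K\<close> bounds the variation on the sphere and \<open>q\<close> on the unit
  ball, the second bounds \<open>q\<close> beyond it.\<close>

lemma rescaled_integral_estimate:
  fixes f :: "'a \<Rightarrow> real"
  assumes f: "integrable lborel f" and D: "gradient_measure f D" and \<delta>: "0 < \<delta>" "\<delta> \<le> 1" and e: "0 < e"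
    and lower: "\<And>x. 0 < norm x \<Longrightarrow> norm x \<le> \<delta> \<Longrightarrow>
      directional_variation D x - e * norm x \<le> shift_distance f x"
    and K: "K = enn2real (variation D UNIV) + 2 * (\<integral>y. \<bar>f y\<bar> \<partial>lborel)"
  defines "q \<equiv> \<lambda>x. shift_distance f x / truncated_norm R x"
  shows "(\<integral>\<^sup>+x. ennreal (q x) \<partial>rescaled_measure R \<nu>) = ennreal (\<integral>x. q x \<partial>rescaled_measure R \<nu>)"
    and "\<bar>(\<integral>x. q x \<partial>rescaled_measure R \<nu>) -
      (\<integral>\<theta>. directional_variation D \<theta> \<partial>angular_measure (rescaled_measure R \<nu>))\<bar>
      \<le> e + K * measure (rescaled_measure R \<nu>) (- cball 0 \<delta>)"
proof -
  let ?M = "rescaled_measure R \<nu>" and ?V = "directional_variation D"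
  interpret L: prob_space ?M by (rule prob_space_rescaled_measure)
  obtain e0 :: 'a where e0: "norm e0 = 1" using vector_choose_size[of 1] by auto
  define n where "n x = (if x = 0 then e0 else x /\<^sub>R norm x)" for x
  have nm: "n \<in> measurable ?M sphere_borel" and ang: "angular_measure ?M = distr ?M sphere_borel n"
    unfolding n_def[abs_def] using angular_measure_eq_distr[OF e0] by auto
  have [measurable]: "f \<in> borel_measurable borel" using borel_measurable_integrable[OF f] by simp
  have [measurable]: "?V \<in> borel_measurable borel"
    by (rule borel_measurable_continuous_onI[OF continuous_directional_variation[OF f D]])
  have [measurable]: "n \<in> borel_measurable borel" unfolding n_def[abs_def] by measurable
  have [measurable]: "shift_distance f \<in> borel_measurable borel"
    unfolding shift_distance_def[abs_def] by (rule lborel.borel_measurable_lebesgue_integral) measurable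
  have [measurable]: "q \<in> borel_measurable borel" unfolding q_def by measurable
  define K0 where "K0 = enn2real (variation D UNIV)"
  have KK: "0 \<le> K0" "K0 \<le> K" "2 * (\<integral>y. \<bar>f y\<bar> \<partial>lborel) \<le> K" by (simp_all add: K0_def K)
  have V_n: "?V x = norm x * ?V (n x)" if "x \<noteq> 0" for x
    using that directional_variation_scale[OF f D, of "norm x" "n x"] by (simp add: n_def)
  have nn: "norm (n x) = 1" for x using e0 by (simp add: n_def)
  have V_bd: "0 \<le> ?V (n x)" "?V (n x) \<le> K0" for x
    using directional_variation_nonneg directional_variation_le_norm[OF f D, of "n x"]
    by (auto simp: nn K0_def)
  have q0: "0 \<le> q x" for x
    unfolding q_def by (simp add: shift_distance_nonneg truncated_norm_nonneg)
  have q_small: "q x \<le> ?V (n x)" if "x \<noteq> 0" "norm x \<le> 1" for x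
    using that shift_distance_le_directional_variation[OF f D, of x]
    unfolding q_def truncated_norm_eq_norm[OF R_ge that(2)] V_n[OF that(1)] by (simp add: field_simps)
  have q_K: "q x \<le> K" for x
  proof (cases "x = 0 \<or> 1 < norm x")
    case False
    then have "q x \<le> ?V (n x)" by (intro q_small) auto
    then show ?thesis using V_bd(2)[of x] KK by linarith
  next
    case True
    show ?thesis
    proof (cases "x = 0")
      case True
      then show ?thesis using KK by (simp add: q_def shift_distance_def)
    next
      case False
      with True have "1 \<le> truncated_norm R x" by (intro truncated_norm_ge_1[OF R_ge]) auto
      then have "q x \<le> shift_distance f x / 1"
        unfolding q_def by (intro divide_left_mono) (auto simp: shift_distance_nonneg)
      then show ?thesis using shift_distance_le_L1[OF f D, of x] KK by linarith
    qed
  qed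
  have close: "\<bar>q x - ?V (n x)\<bar> \<le> e + K * indicator (- cball 0 \<delta>) x" if "x \<noteq> 0" for x
  proof (cases "norm x \<le> \<delta>")
    case True
    then have n1: "norm x \<le> 1" using \<delta> by simp
    have "norm x * ?V (n x) - e * norm x \<le> shift_distance f x"
      using lower[of x] True that unfolding V_n[OF that] by simp
    then have "?V (n x) - e \<le> q x"
      unfolding q_def truncated_norm_eq_norm[OF R_ge n1] using that by (simp add: field_simps)
    then show ?thesis using q_small[OF that n1] e True by (simp add: indicator_def)
  next
    case False
    then show ?thesis using q0[of x] q_K[of x] V_bd[of x] KK e by (simp add: indicator_def abs_le_iff)
  qed
  have intq: "integrable ?M q"
    by (rule L.integrable_const_bound[of _ K]) (use q0 q_K in auto)
  have intV: "integrable ?M (\<lambda>x. ?V (n x))"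
    by (rule L.integrable_const_bound[of _ K0]) (use V_bd in auto)
  show "(\<integral>\<^sup>+x. ennreal (q x) \<partial>?M) = ennreal (\<integral>x. q x \<partial>?M)"
    using q0 by (intro nn_integral_eq_integral intq) auto
  have [measurable]: "- cball 0 \<delta> \<in> sets ?M" by (simp add: sets_rescaled_measure)
  have "(\<integral>\<theta>. ?V \<theta> \<partial>angular_measure ?M) = (\<integral>x. ?V (n x) \<partial>?M)"
    unfolding ang by (rule integral_distr[OF nm]) (rule measurable_restrict_space1, simp)
  then have "\<bar>(\<integral>x. q x \<partial>?M) - (\<integral>\<theta>. ?V \<theta> \<partial>angular_measure ?M)\<bar> = \<bar>\<integral>x. q x - ?V (n x) \<partial>?M\<bar>"
    using intq intV by simp
  also have "\<dots> \<le> (\<integral>x. \<bar>q x - ?V (n x)\<bar> \<partial>?M)" by simp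
  also have "\<dots> \<le> (\<integral>x. e + K * indicator (- cball 0 \<delta>) x \<partial>?M)"
  proof (rule integral_mono_AE)
    show "AE x in ?M. \<bar>q x - ?V (n x)\<bar> \<le> e + K * indicator (- cball 0 \<delta>) x"
      using rescaled_measure_AE_nonzero by eventually_elim (rule close)
  qed (use intq intV in \<open>auto simp: L.emeasure_eq_measure\<close>)
  also have "\<dots> = e + K * measure ?M (- cball 0 \<delta>)"
    using L.prob_space by (simp add: L.emeasure_eq_measure space_rescaled_measure)
  finally show "\<bar>(\<integral>x. q x \<partial>?M) - (\<integral>\<theta>. ?V \<theta> \<partial>angular_measure ?M)\<bar> \<le> e + K * measure ?M (- cball 0 \<delta>)" .
qed

end

section \<open>Extraction of the subsequence and passage to the limit\<close>

theorem theorem3p3: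
  fixes \<nu> :: "real \<Rightarrow> 'a::euclidean_space measure" and R :: "real \<Rightarrow> ennreal"
  assumes borel: "\<And>\<epsilon>. \<epsilon> > 0 \<Longrightarrow> sets (\<nu> \<epsilon>) = sets borel"
    and moment: "\<And>\<epsilon>. \<epsilon> > 0 \<Longrightarrow> (\<integral>\<^sup>+ x. ennreal (min 1 (norm x)) \<partial>\<nu> \<epsilon>) < \<infinity>"
    and origin: "\<And>\<epsilon>. \<epsilon> > 0 \<Longrightarrow> emeasure (\<nu> \<epsilon>) {0} = 0"
    and R_ge: "\<And>\<epsilon>. \<epsilon> > 0 \<Longrightarrow> 1 \<le> R \<epsilon>"
    and C_pos: "\<And>\<epsilon>. \<epsilon> > 0 \<Longrightarrow> 0 < truncated_moment (R \<epsilon>) (\<nu> \<epsilon>)"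
    and C_finite: "\<And>\<epsilon>. \<epsilon> > 0 \<Longrightarrow> truncated_moment (R \<epsilon>) (\<nu> \<epsilon>) < \<infinity>"
    and concentration: "\<And>\<rho>::real. \<rho> > 0 \<Longrightarrow>
      ((\<lambda>\<epsilon>. emeasure (rescaled_measure (R \<epsilon>) (\<nu> \<epsilon>)) (- cball 0 \<rho>)) \<longlongrightarrow> 0) (at_right 0)"
  shows "\<exists>(e :: nat \<Rightarrow> real) (\<mu> :: 'a measure).
    (\<forall>j. e j > 0) \<and> e \<longlonglongrightarrow> 0 \<and>
    prob_space \<mu> \<and> sets \<mu> = sets sphere_borel \<and>
    weak_limit (\<lambda>j. angular_measure (rescaled_measure (R (e j)) (\<nu> (e j)))) \<mu> \<and>
    (\<forall>f\<in>BV. \<forall>D. gradient_measure f D \<longrightarrow>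
      (\<lambda>j. inverse (truncated_moment (R (e j)) (\<nu> (e j))) * nonlocal_energy (\<nu> (e j)) f)
        \<longlonglongrightarrow> 1 / 2 * (\<integral>\<^sup>+ \<theta>. variation (\<lambda>A. D A \<bullet> \<theta>) UNIV \<partial>\<mu>))"
proof -
  let ?L = "\<lambda>\<epsilon>. rescaled_measure (R \<epsilon>) (\<nu> \<epsilon>)"
  let ?M = "\<lambda>n. angular_measure (?L (inverse (real (Suc n))))"
  have pos: "0 < inverse (real (Suc n))" for n by simp
  have "prob_space (?M n)" "sets (?M n) = sets sphere_borel" for n
    using prob_space_angular_measure[OF borel[OF pos] R_ge[OF pos] C_pos[OF pos] C_finite[OF pos]] by auto
  \<comment> \<open>Only the angular measures decide the subsequence. For every \<open>f\<close> the
    directional variation is continuous on the sphere, so the same subsequence serves all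
    \<open>f\<close>.\<close>
  then obtain r \<mu> where r: "strict_mono r" and \<mu>: "prob_space \<mu>" "sets \<mu> = sets sphere_borel"
    and lim: "weak_limit (\<lambda>n. ?M (r n)) \<mu>"
    using sphere_weakly_compact[of ?M] by blast
  define e where "e n = inverse (real (Suc (r n)))" for n
  have e_pos: "0 < e n" for n by (simp add: e_def)
  have e_lim: "e \<longlonglongrightarrow> 0"
    using LIMSEQ_subseq_LIMSEQ[OF LIMSEQ_inverse_real_of_nat r] by (simp add: e_def[abs_def] comp_def)
  have lim': "weak_limit (\<lambda>n. angular_measure (?L (e n))) \<mu>" using lim by (simp add: e_def)
  interpret \<mu>: prob_space \<mu> by (rule \<mu>(1))
  have sp\<mu>: "space \<mu> = sphere 0 1" using sets_eq_imp_space_eq[OF \<mu>(2)] by (simp add: space_restrict_space)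
  have e_right: "filterlim e (at_right 0) sequentially"
    unfolding filterlim_at
  proof (intro conjI always_eventually allI e_lim)
    show "e n \<in> {0<..}" "e n \<noteq> 0" for n using e_pos[of n] by auto
  qed
  note props = borel[OF e_pos] R_ge[OF e_pos] C_pos[OF e_pos] C_finite[OF e_pos]
  have "(\<lambda>j. inverse (truncated_moment (R (e j)) (\<nu> (e j))) * nonlocal_energy (\<nu> (e j)) f)
        \<longlonglongrightarrow> 1 / 2 * (\<integral>\<^sup>+ \<theta>. variation (\<lambda>A. D A \<bullet> \<theta>) UNIV \<partial>\<mu>)"
    if "f \<in> BV" and D: "gradient_measure f D" for f D
  proof -
    have f: "integrable lborel f" using \<open>f \<in> BV\<close> by (simp add: BV_def)
    let ?V = "directional_variation D"
    define q where "q j x = shift_distance f x / truncated_norm (R (e j)) x" for j x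
    let ?I = "\<lambda>j. \<integral>x. q j x \<partial>?L (e j)"
    define K where "K = enn2real (variation D UNIV) + 2 * (\<integral>y. \<bar>f y\<bar> \<partial>lborel)"
    have V_bounded: "norm (?V \<theta>) \<le> enn2real (variation D UNIV)" if "\<theta> \<in> sphere 0 1" for \<theta>
      using directional_variation_nonneg[of D \<theta>] directional_variation_le_norm[OF f D, of \<theta>] that by simp
    \<comment> \<open>The radius \<open>\<delta>\<close> does not depend on \<open>j\<close>, since
      the lower bound behind it concerns \<open>f\<close> alone. The identity of the two integrals
      is carried along for the return to \<open>ennreal\<close> at the end.\<close>
    have est: "\<exists>\<delta>>0. \<forall>j. (\<integral>\<^sup>+x. ennreal (q j x) \<partial>?L (e j)) = ennreal (?I j) \<and>
        \<bar>?I j - (\<integral>\<theta>. ?V \<theta> \<partial>angular_measure (?L (e j)))\<bar> \<le> \<eta> + K * measure (?L (e j)) (- cball 0 \<delta>)"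
      if \<eta>: "0 < \<eta>" for \<eta>
    proof -
      obtain \<delta>0 where \<delta>0: "0 < \<delta>0" "\<And>x. 0 < norm x \<Longrightarrow> norm x < \<delta>0 \<Longrightarrow> ?V x - \<eta> * norm x \<le> shift_distance f x"
        using shift_distance_uniform_lower[OF f D \<eta>] by blast
      \<comment> \<open>Halving turns the strict inequality \<open>norm x < \<delta>0\<close> into
        the closed ball \<open>norm x \<le> \<delta>\<close>; the cap at 1 keeps the ball where the
        truncated norm is the norm.\<close>
      define \<delta> where "\<delta> = min 1 (\<delta>0 / 2)"
      have \<delta>: "0 < \<delta>" "\<delta> \<le> 1" "\<delta> < \<delta>0" using \<delta>0(1) by (auto simp: \<delta>_def min_def)
      have lower: "?V x - \<eta> * norm x \<le> shift_distance f x" if "0 < norm x" "norm x \<le> \<delta>" for x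
        using \<delta>0(2)[of x] that \<delta>(3) by linarith
      show ?thesis
        using rescaled_integral_estimate[OF props f D \<delta>(1,2) \<eta> lower K_def] \<delta>(1)
        unfolding q_def by blast
    qed
    have "(\<lambda>j. ?I j - (\<integral>\<theta>. ?V \<theta> \<partial>angular_measure (?L (e j)))) \<longlonglongrightarrow> 0"
    proof (rule LIMSEQ_I)
      fix \<eta> :: real assume "0 < \<eta>"
      then obtain \<delta> where \<delta>: "0 < \<delta>" "\<And>j. \<bar>?I j - (\<integral>\<theta>. ?V \<theta> \<partial>angular_measure (?L (e j)))\<bar>
          \<le> \<eta> / 2 + K * measure (?L (e j)) (- cball 0 \<delta>)"
        using est[of "\<eta> / 2"] by auto
      have "(\<lambda>j. emeasure (?L (e j)) (- cball 0 \<delta>)) \<longlonglongrightarrow> 0"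
        using filterlim_compose[OF concentration[OF \<delta>(1)] e_right] .
      then have "(\<lambda>j. measure (?L (e j)) (- cball 0 \<delta>)) \<longlonglongrightarrow> 0"
        unfolding measure_def by (intro tendsto_enn2real) simp_all
      then have "(\<lambda>j. K * measure (?L (e j)) (- cball 0 \<delta>)) \<longlonglongrightarrow> 0"
        using tendsto_mult_right_zero by blast
      then have "\<forall>\<^sub>F j in sequentially. K * measure (?L (e j)) (- cball 0 \<delta>) < \<eta> / 2"
        using \<open>0 < \<eta>\<close> by (intro order_tendstoD(2)) auto
      then obtain N where N: "\<And>j. N \<le> j \<Longrightarrow> K * measure (?L (e j)) (- cball 0 \<delta>) < \<eta> / 2"
        unfolding eventually_sequentially by blast
      show "\<exists>N. \<forall>j\<ge>N. norm (?I j - (\<integral>\<theta>. ?V \<theta> \<partial>angular_measure (?L (e j))) - 0) < \<eta>"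
      proof (intro exI allI impI)
        fix j assume "N \<le> j"
        then show "norm (?I j - (\<integral>\<theta>. ?V \<theta> \<partial>angular_measure (?L (e j))) - 0) < \<eta>"
          using \<delta>(2)[of j] N[of j] by simp
      qed
    qed
    moreover have "(\<lambda>j. \<integral>\<theta>. ?V \<theta> \<partial>angular_measure (?L (e j))) \<longlonglongrightarrow> (\<integral>\<theta>. ?V \<theta> \<partial>\<mu>)"
    proof -
      have "bounded (?V ` sphere 0 1)" unfolding bounded_iff using V_bounded by blast
      then show ?thesis
        using lim' continuous_directional_variation[OF f D] unfolding weak_limit_def sp\<mu> by blast
    qed
    ultimately have "?I \<longlonglongrightarrow> (\<integral>\<theta>. ?V \<theta> \<partial>\<mu>)" using tendsto_add by fastforce
    \<comment> \<open>In \<open>ennreal\<close>, multiplication by a constant respects limits when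
      the constant is finite.\<close>
    moreover have "1 / 2 < (\<top> :: ennreal)"
      using divide_ennreal[of 1 2] ennreal_less_top[of "1 / 2"] by simp
    ultimately have "(\<lambda>j. 1 / 2 * ennreal (?I j)) \<longlonglongrightarrow> 1 / 2 * ennreal (\<integral>\<theta>. ?V \<theta> \<partial>\<mu>)"
      by (intro ennreal_tendsto_cmult tendsto_ennrealI)
    moreover have "inverse (truncated_moment (R (e j)) (\<nu> (e j))) * nonlocal_energy (\<nu> (e j)) f = 1 / 2 * ennreal (?I j)" for j
      unfolding nonlocal_energy_eq[OF props f] using est[of 1] by (auto simp: q_def)
    moreover have "ennreal (\<integral>\<theta>. ?V \<theta> \<partial>\<mu>) = (\<integral>\<^sup>+ \<theta>. variation (\<lambda>A. D A \<bullet> \<theta>) UNIV \<partial>\<mu>)"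
    proof -
      have "?V \<in> borel_measurable \<mu>"
        unfolding measurable_cong_sets[OF \<mu>(2) refl]
        by (rule borel_measurable_continuous_on_restrict[OF continuous_directional_variation[OF f D]])
      then have "integrable \<mu> ?V"
        by (intro \<mu>.integrable_const_bound[of _ "enn2real (variation D UNIV)"] AE_I2)
           (rule V_bounded, unfold sp\<mu>)
      then show ?thesis
        unfolding variation_eq_directional_variation[OF f D]
        by (intro nn_integral_eq_integral[symmetric]) (auto simp: directional_variation_nonneg)
    qed
    ultimately show ?thesis by simp
  qed
  then show ?thesis using e_pos e_lim \<mu> lim' by (intro exI[of _ e] exI[of _ \<mu>]) auto
qed

end
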